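(* Let $\mathcal{A}=(\mathcal{A},m,f)$ be a presheaf of $k$-algebras on a small category $\mathcal{U}$, with Gerstenhaber–Schack complex $\mathbf{C}_{\mathrm{GS}}(\mathcal{A})$. \begin{enumerate} \item (a) For $(m_1,f_1,c_1)\in \mathbf{C}^{0,2}(\mathcal{A})\oplus\mathbf{C}^{1,1}(\mathcal{A})\oplus\mathbf{C}^{2,0}(\mathcal{A})$, the tuple $(\mathcal{A}[\epsilon],\bar m=m+m_1\epsilon,\bar f=f+f_1\epsilon,\bar c=1+c_1\epsilon)$ is a first order twisted deformation of $\mathcal{A}$ if and only if $(m_1,f_1,c_1)\in\bar{\mathbf{C}}'^2_{\mathrm{GS}}(\mathcal{A})$ and $d_{\mathrm{GS}}(m_1,f_1,c_1)=0$. (b) For $(m_1,f_1)\in \mathbf{C}^{0,2}(\mathcal{A})\oplus\mathbf{C}^{1,1}(\mathcal{A})$, the tuple $(\mathcal{A}[\epsilon],m+m_1\epsilon,f+f_1\epsilon)$ is a first order presheaf deformation of $\mathcal{A}$ if and only if $(m_1,f_1)\in\bar{\mathbf{C}}'^2_{\mathrm{tGS}}(\mathcal{A})$ and $d_{\mathrm{GS}}(m_1,f_1)=0$. \item (a) For $(m_1,f_1,c_1),(m_1',f_1',c_1')\in Z^2\bar{\mathbf{C}}'_{\mathrm{GS}}(\mathcal{A})$ with associated twisted deformations $\bar{\mathcal{A}},\bar{\mathcal{A}}'$, and $(g_1,-\tau_1)\in\mathbf{C}^{0,1}(\mathcal{A})\oplus\mathbf{C}^{1,0}(\mathcal{A})$,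 the pair $(g,\tau)=(1+g_1\epsilon,1+\tau_1\epsilon)$ is an isomorphism of twisted presheaves $\bar{\mathcal{A}}\to\bar{\mathcal{A}}'$ if and only if $(g_1,-\tau_1)\in\bar{\mathbf{C}}'^1_{\mathrm{GS}}(\mathcal{A})$ and $d_{\mathrm{GS}}(g_1,-\tau_1)=(m_1,f_1,c_1)-(m_1',f_1',c_1')$. (b) For $(m_1,f_1),(m_1',f_1')\in Z^2\bar{\mathbf{C}}'_{\mathrm{tGS}}(\mathcal{A})$ and $g_1\in\mathbf{C}^{0,1}(\mathcal{A})$, the family $g=1+g_1\epsilon$ is an isomorphism of presheaves between the associated presheaf deformations if and only if $g_1\in\bar{\mathbf{C}}'^1_{\mathrm{tGS}}(\mathcal{A})$ and $d_{\mathrm{GS}}(g_1)=(m_1,f_1)-(m_1',f_1')$. \item (a) The assignment sending the class of a cocycle $(m_1,f_1,c_1)$ to the class of $(\mathcal{A}[\epsilon],m+m_1\epsilon,f+f_1\epsilon,1+c_1\epsilon)$ is a well-defined bijection $H^2\bar{\mathbf{C}}'_{\mathrm{GS}}(\mathcal{A})\to\mathrm{Def}_{\mathrm{tw}}(\mathcal{A})$; hence the second Hochschild cohomology $HH^2(\mathcal{A})\cong H^2\bar{\mathbf{C}}'_{\mathrm{GS}}(\mathcal{A})$ classifies first order twisted deformations of $\mathcal{A}$ up to equivalence. (b) Similarly the class of $(m_1,f_1)$ maps to the class of $(\mathcal{A}[\epsilon],m+m_1\epsilon,f+f_1\epsilon)$, giving a bijection $H^2\bar{\mathbf{C}}'_{\mathrm{tGS}}(\mathcal{A})\to\mathrm{Def}_{\mathrm{pr}}(\mathcal{A})$,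 so $H^2\bar{\mathbf{C}}'_{\mathrm{tGS}}(\mathcal{A})$ classifies first order presheaf deformations of $\mathcal{A}$ up to equivalence. \end{enumerate}
   Context: $k$ is a commutative ring with unit, $k[\epsilon]=k[\epsilon]/(\epsilon^2)$; algebras are unital associative and algebra maps preserve units. For a presheaf $\mathcal{A}$ of $k$-algebras on a small category $\mathcal{U}$ write $m^U$ for the multiplication of $\mathcal{A}(U)$ and $f^u=u^*\colon\mathcal{A}(U)\to\mathcal{A}(V)$ for the restriction along $u\colon V\to U$. Nerve: a $p$-simplex is $\sigma=(U_0\xrightarrow{u_1}U_1\to\cdots\xrightarrow{u_p}U_p)$, $d\sigma=U_0$, $c\sigma=U_p$, $f^\sigma=f^{u_p\cdots u_1}$; $\sigma$ is degenerate if some $u_i$ is an identity. For a $(p+1)$-simplex $\sigma$: $\partial_0\sigma$ deletes $U_0$, $\partial_{p+1}\sigma$ deletes $U_{p+1}$, and $\partial_i\sigma$ ($1\le i\le p$) replaces $U_{i-1}\to U_i\to U_{i+1}$ by $u_{i+1}u_i$. Gerstenhaber–Schack (GS) complex: $\mathbf{C}^{p,q}(\mathcal{A})=\prod_{\sigma\in\mathcal{N}_p(\mathcal{U})}\mathrm{Hom}_k(\mathcal{A}(c\sigma)^{\otimes q},\mathcal{A}(d\sigma))$, with $\mathcal{A}(d\sigma)$ an $\mathcal{A}(c\sigma)$-bimodule via $f^\sigma$. Vertical differential $d_{\mathrm{Hoch}}$ is componentwise the Hochschild differential $d\phi(a_n,\dots,a_0)=a_n\phi(a_{n-1},\dots,a_0)+\sum_{i=0}^{n-1}(-1)^{i+1}\phi(a_n,\dots,a_{n-i}a_{n-i-1},\dots,a_0)+(-1)^{n+1}\phi(a_n,\dots,a_1)a_0$.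 Horizontal differential $d_{\mathrm{simp}}=\sum_{i=0}^{p+1}(-1)^id_i\colon\mathbf{C}^{p,q}\to\mathbf{C}^{p+1,q}$ where, for $\sigma\in\mathcal{N}_{p+1}(\mathcal{U})$, $(d_0\phi)^\sigma=f^{u_1}\circ\phi^{\partial_0\sigma}$, $(d_i\phi)^\sigma=\phi^{\partial_i\sigma}$ for $1\le i\le p$, and $(d_{p+1}\phi)^\sigma=\phi^{\partial_{p+1}\sigma}\circ(f^{u_{p+1}})^{\otimes q}$. The total complex $\mathbf{C}^n_{\mathrm{GS}}(\mathcal{A})=\bigoplus_{p+q=n}\mathbf{C}^{p,q}(\mathcal{A})$ has differential $d_{\mathrm{GS}}=(-1)^{n+1}d_{\mathrm{simp}}+d_{\mathrm{Hoch}}$ on degree $n$. A cochain $\phi=(\phi^\sigma)$ is normalized if each $\phi^\sigma$ vanishes whenever one argument equals $1$, and reduced if $\phi^\sigma=0$ for degenerate $\sigma$ ($p=0$ cochains are reduced). $\bar{\mathbf{C}}'_{\mathrm{GS}}(\mathcal{A})$ is the subcomplex of normalized reduced cochains; $\mathbf{C}_{\mathrm{tGS}}$ (resp. $\bar{\mathbf{C}}'_{\mathrm{tGS}}$) is the subcomplex with $q\ge1$ (the truncated complex). $HH^n(\mathcal{A})$ denotes the GS Hochschild cohomology $H^n\mathbf{C}_{\mathrm{GS}}(\mathcal{A})$. A twisted presheaf of algebras (with trivial unit twist) $(\mathcal{A},m,f,c)$: algebras $\mathcal{A}(U)$, algebra maps $f^u=u^*$ with $f^{1_U}=1$, invertible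 $c^{u,v}\in\mathcal{A}(W)$ for $v\colon W\to V$, $u\colon V\to U$ with $c^{u,v}v^*u^*(a)=(uv)^*(a)c^{u,v}$, $c^{u,vw}c^{v,w}=c^{uv,w}w^*(c^{u,v})$, $c^{u,1_V}=1=c^{1_U,u}$. A morphism $(g,\tau)\colon\mathcal{A}\to\mathcal{A}'$: unital algebra maps $g^U$ and invertible $\tau^u\in\mathcal{A}'(V)$ with $g^V(u^*a)\tau^u=\tau^u u'^*(g^U a)$, $\tau^{uv}c'^{u,v}=g^W(c^{u,v})\tau^v v'^*(\tau^u)$, $\tau^{1_U}=1$; it is an isomorphism iff all $g^U$ are. A first order twisted deformation of a presheaf $\mathcal{A}$ is a twisted presheaf of $k[\epsilon]$-algebras of the form $(\mathcal{A}[\epsilon],m+m_1\epsilon,f+f_1\epsilon,1+c_1\epsilon)$ (structure maps extended $k[\epsilon]$-(bi)linearly), $(m_1,f_1,c_1)\in\mathbf{C}^{0,2}\oplus\mathbf{C}^{1,1}\oplus\mathbf{C}^{2,0}$, such that each $(\mathcal{A}(U)[\epsilon],m^U+m_1^U\epsilon)$ is a $k[\epsilon]$-algebra with the same unit as $\mathcal{A}(U)$. It is a presheaf deformation if $c_1=0$. An equivalence of twisted deformations is an isomorphism $(g,\tau)=(1+g_1\epsilon,1+\tau_1\epsilon)$ with $(g_1,\tau_1)\in\mathbf{C}^{0,1}\oplus\mathbf{C}^{1,0}$; an equivalence of presheaf deformations is an isomorphism of presheaves $1+g_1\epsilon$, $g_1\in\mathbf{C}^{0,1}$. $\mathrm{Def}_{\mathrm{tw}}(\mathcal{A})$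 and $\mathrm{Def}_{\mathrm{pr}}(\mathcal{A})$ are the sets of equivalence classes. *)

theory Defs
  imports Main
begin

section \<open>Dual numbers k[eps] = k[eps]/(eps^2)\<close>

datatype 'k dual = Dual (re: 'k) (eps: 'k)

instantiation dual :: (comm_ring_1) comm_ring_1
begin
definition zero_dual_def: "0 = Dual 0 0"
definition one_dual_def: "1 = Dual 1 0"
definition plus_dual_def: "x + y = Dual (re x + re y) (eps x + eps y)"
definition minus_dual_def: "x - y = Dual (re x - re y) (eps x - eps y)"
definition uminus_dual_def: "- x = Dual (- re x) (- eps x)"
definition times_dual_def: "x * y = Dual (re x * re y) (re x * eps y + eps x * re y)"
instance
  by intro_classes
     (auto simp: zero_dual_def one_dual_def plus_dual_def minus_dual_def
                 uminus_dual_def times_dual_def dual.expand algebra_simps)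
end

text \<open>A morphism u with Dom u = V and Cod u = U is u : V -> U; Comp u v is u o v
  (first v, then u).\<close>

record ('o,'m) cat =
  Ob :: "'o set"
  Mor :: "'m set"
  Dom :: "'m \<Rightarrow> 'o"
  Cod :: "'m \<Rightarrow> 'o"
  Comp :: "'m \<Rightarrow> 'm \<Rightarrow> 'm"
  Ident :: "'o \<Rightarrow> 'm"

definition is_category :: "('o,'m) cat \<Rightarrow> bool" where
  "is_category C \<longleftrightarrow>
     (\<forall>u\<in>Mor C. Dom C u \<in> Ob C \<and> Cod C u \<in> Ob C) \<and>
     (\<forall>U\<in>Ob C. Ident C U \<in> Mor C \<and> Dom C (Ident C U) = U \<and> Cod C (Ident C U) = U) \<and>
     (\<forall>u\<in>Mor C. \<forall>v\<in>Mor C. Cod C v = Dom C u \<longrightarrow>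
        Comp C u v \<in> Mor C \<and> Dom C (Comp C u v) = Dom C v \<and> Cod C (Comp C u v) = Cod C u) \<and>
     (\<forall>u\<in>Mor C. \<forall>v\<in>Mor C. \<forall>w\<in>Mor C. Cod C w = Dom C v \<and> Cod C v = Dom C u \<longrightarrow>
        Comp C (Comp C u v) w = Comp C u (Comp C v w)) \<and>
     (\<forall>u\<in>Mor C. Comp C u (Ident C (Dom C u)) = u \<and> Comp C (Ident C (Cod C u)) u = u)"

text \<open>A family of R-algebras indexed by objects, all elements living in one type 'a,
  with carriers, together with restriction maps (pres u : A(Cod u) -> A(Dom u)) and
  twists (ptw u v in A(Dom v) for v : W -> V, u : V -> U).\<close>

record ('o,'m,'a,'r) tpsh =
  pcar :: "'o \<Rightarrow> 'a set"
  padd :: "'o \<Rightarrow> 'a \<Rightarrow> 'a \<Rightarrow> 'a"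
  pzero :: "'o \<Rightarrow> 'a"
  psmult :: "'o \<Rightarrow> 'r \<Rightarrow> 'a \<Rightarrow> 'a"
  pmul :: "'o \<Rightarrow> 'a \<Rightarrow> 'a \<Rightarrow> 'a"
  pone :: "'o \<Rightarrow> 'a"
  pres :: "'m \<Rightarrow> 'a \<Rightarrow> 'a"
  ptw :: "'m \<Rightarrow> 'm \<Rightarrow> 'a"

definition is_algebra :: "('o,'m,'a,'r::comm_ring_1) tpsh \<Rightarrow> 'o \<Rightarrow> bool" where
  "is_algebra T U \<longleftrightarrow>
    (let S = pcar T U; ad = padd T U; z = pzero T U; sm = psmult T U; mu = pmul T U; e = pone T U in
     z \<in> S \<and> e \<in> S \<and>
     (\<forall>a\<in>S. \<forall>b\<in>S. ad a b \<in> S \<and> mu a b \<in> S) \<and>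
     (\<forall>r. \<forall>a\<in>S. sm r a \<in> S) \<and>
     (\<forall>a\<in>S. \<forall>b\<in>S. \<forall>c\<in>S. ad (ad a b) c = ad a (ad b c)) \<and>
     (\<forall>a\<in>S. \<forall>b\<in>S. ad a b = ad b a) \<and>
     (\<forall>a\<in>S. ad z a = a) \<and>
     (\<forall>a\<in>S. \<exists>b\<in>S. ad a b = z) \<and>
     (\<forall>r s. \<forall>a\<in>S. sm (r + s) a = ad (sm r a) (sm s a)) \<and>
     (\<forall>r. \<forall>a\<in>S. \<forall>b\<in>S. sm r (ad a b) = ad (sm r a) (sm r b)) \<and>
     (\<forall>r s. \<forall>a\<in>S. sm (r * s) a = sm r (sm s a)) \<and>
     (\<forall>a\<in>S. sm 1 a = a) \<and>
     (\<forall>a\<in>S. \<forall>b\<in>S. \<forall>c\<in>S. mu (mu a b) c = mu a (mu b c)) \<and>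
     (\<forall>a\<in>S. mu e a = a \<and> mu a e = a) \<and>
     (\<forall>a\<in>S. \<forall>b\<in>S. \<forall>c\<in>S. mu a (ad b c) = ad (mu a b) (mu a c) \<and> mu (ad a b) c = ad (mu a c) (mu b c)) \<and>
     (\<forall>r. \<forall>a\<in>S. \<forall>b\<in>S. mu (sm r a) b = sm r (mu a b) \<and> mu a (sm r b) = sm r (mu a b)))"

definition alg_map :: "('o,'m,'a,'r::comm_ring_1) tpsh \<Rightarrow> 'o \<Rightarrow> ('o,'m,'b,'r) tpsh \<Rightarrow> 'o \<Rightarrow> ('a \<Rightarrow> 'b) \<Rightarrow> bool" where
  "alg_map T U T' V h \<longleftrightarrow>
     (\<forall>a\<in>pcar T U. h a \<in> pcar T' V) \<and>
     (\<forall>a\<in>pcar T U. \<forall>b\<in>pcar T U. h (padd T U a b) = padd T' V (h a) (h b)) \<and>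
     (\<forall>r. \<forall>a\<in>pcar T U. h (psmult T U r a) = psmult T' V r (h a)) \<and>
     (\<forall>a\<in>pcar T U. \<forall>b\<in>pcar T U. h (pmul T U a b) = pmul T' V (h a) (h b)) \<and>
     h (pone T U) = pone T' V"

definition invertible :: "('o,'m,'a,'r) tpsh \<Rightarrow> 'o \<Rightarrow> 'a \<Rightarrow> bool" where
  "invertible T U x \<longleftrightarrow> (\<exists>y\<in>pcar T U. pmul T U x y = pone T U \<and> pmul T U y x = pone T U)"

text \<open>Presheaf of R-algebras (the twist field is ignored).\<close>
definition is_presheaf :: "('o,'m) cat \<Rightarrow> ('o,'m,'a,'r::comm_ring_1) tpsh \<Rightarrow> bool" where
  "is_presheaf C T \<longleftrightarrow>
     (\<forall>U\<in>Ob C. is_algebra T U) \<and>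
     (\<forall>u\<in>Mor C. alg_map T (Cod C u) T (Dom C u) (pres T u)) \<and>
     (\<forall>U\<in>Ob C. \<forall>a\<in>pcar T U. pres T (Ident C U) a = a) \<and>
     (\<forall>u\<in>Mor C. \<forall>v\<in>Mor C. Cod C v = Dom C u \<longrightarrow>
        (\<forall>a\<in>pcar T (Cod C u). pres T (Comp C u v) a = pres T v (pres T u a)))"

definition is_tw_presheaf :: "('o,'m) cat \<Rightarrow> ('o,'m,'a,'r::comm_ring_1) tpsh \<Rightarrow> bool" where
  "is_tw_presheaf C T \<longleftrightarrow>
     (\<forall>U\<in>Ob C. is_algebra T U) \<and>
     (\<forall>u\<in>Mor C. alg_map T (Cod C u) T (Dom C u) (pres T u)) \<and>
     (\<forall>U\<in>Ob C. \<forall>a\<in>pcar T U. pres T (Ident C U) a = a) \<and>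
     (\<forall>u\<in>Mor C. \<forall>v\<in>Mor C. Cod C v = Dom C u \<longrightarrow>
        ptw T u v \<in> pcar T (Dom C v) \<and> invertible T (Dom C v) (ptw T u v) \<and>
        (\<forall>a\<in>pcar T (Cod C u).
           pmul T (Dom C v) (ptw T u v) (pres T v (pres T u a)) =
           pmul T (Dom C v) (pres T (Comp C u v) a) (ptw T u v))) \<and>
     (\<forall>u\<in>Mor C. \<forall>v\<in>Mor C. \<forall>w\<in>Mor C. Cod C w = Dom C v \<and> Cod C v = Dom C u \<longrightarrow>
        pmul T (Dom C w) (ptw T u (Comp C v w)) (ptw T v w) =
        pmul T (Dom C w) (ptw T (Comp C u v) w) (pres T w (ptw T u v))) \<and>
     (\<forall>u\<in>Mor C. ptw T u (Ident C (Dom C u)) = pone T (Dom C u) \<and>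
                ptw T (Ident C (Cod C u)) u = pone T (Dom C u))"

definition is_tw_morphism :: "('o,'m) cat \<Rightarrow> ('o,'m,'a,'r::comm_ring_1) tpsh \<Rightarrow> ('o,'m,'b,'r) tpsh
     \<Rightarrow> ('o \<Rightarrow> 'a \<Rightarrow> 'b) \<Rightarrow> ('m \<Rightarrow> 'b) \<Rightarrow> bool" where
  "is_tw_morphism C T T' g \<tau> \<longleftrightarrow>
     (\<forall>U\<in>Ob C. alg_map T U T' U (g U)) \<and>
     (\<forall>u\<in>Mor C. \<tau> u \<in> pcar T' (Dom C u) \<and> invertible T' (Dom C u) (\<tau> u) \<and>
        (\<forall>a\<in>pcar T (Cod C u).
           pmul T' (Dom C u) (g (Dom C u) (pres T u a)) (\<tau> u) =
           pmul T' (Dom C u) (\<tau> u) (pres T' u (g (Cod C u) a)))) \<and>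
     (\<forall>u\<in>Mor C. \<forall>v\<in>Mor C. Cod C v = Dom C u \<longrightarrow>
        pmul T' (Dom C v) (\<tau> (Comp C u v)) (ptw T' u v) =
        pmul T' (Dom C v) (pmul T' (Dom C v) (g (Dom C v) (ptw T u v)) (\<tau> v)) (pres T' v (\<tau> u))) \<and>
     (\<forall>U\<in>Ob C. \<tau> (Ident C U) = pone T' U)"

definition is_tw_iso :: "('o,'m) cat \<Rightarrow> ('o,'m,'a,'r::comm_ring_1) tpsh \<Rightarrow> ('o,'m,'b,'r) tpsh
     \<Rightarrow> ('o \<Rightarrow> 'a \<Rightarrow> 'b) \<Rightarrow> ('m \<Rightarrow> 'b) \<Rightarrow> bool" where
  "is_tw_iso C T T' g \<tau> \<longleftrightarrow> is_tw_morphism C T T' g \<tau> \<and>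
     (\<forall>U\<in>Ob C. bij_betw (g U) (pcar T U) (pcar T' U))"

definition is_pr_iso :: "('o,'m) cat \<Rightarrow> ('o,'m,'a,'r::comm_ring_1) tpsh \<Rightarrow> ('o,'m,'b,'r) tpsh
     \<Rightarrow> ('o \<Rightarrow> 'a \<Rightarrow> 'b) \<Rightarrow> bool" where
  "is_pr_iso C T T' g \<longleftrightarrow>
     (\<forall>U\<in>Ob C. alg_map T U T' U (g U) \<and> bij_betw (g U) (pcar T U) (pcar T' U)) \<and>
     (\<forall>u\<in>Mor C. \<forall>a\<in>pcar T (Cod C u). g (Dom C u) (pres T u a) = pres T' u (g (Cod C u) a))"

section \<open>Nerve\<close>

text \<open>A p-simplex (U0 -u1-> U1 -> ... -up-> Up) is the pair (U0, [u1,...,up]).\<close>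

definition nerve :: "('o,'m) cat \<Rightarrow> nat \<Rightarrow> ('o \<times> 'm list) set" where
  "nerve C p = {(U, us). U \<in> Ob C \<and> length us = p \<and> set us \<subseteq> Mor C \<and>
      (\<forall>i<length us. Dom C (us ! i) = (if i = 0 then U else Cod C (us ! (i - 1))))}"

definition sdom :: "('o \<times> 'm list) \<Rightarrow> 'o" where
  "sdom \<sigma> = fst \<sigma>"

definition scod :: "('o,'m) cat \<Rightarrow> ('o \<times> 'm list) \<Rightarrow> 'o" where
  "scod C \<sigma> = (if snd \<sigma> = [] then fst \<sigma> else Cod C (last (snd \<sigma>)))"

text \<open>The composite u_p ... u_1 (identity of U0 if p = 0).\<close>
definition comp_chain :: "('o,'m) cat \<Rightarrow> ('o \<times> 'm list) \<Rightarrow> 'm" where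
  "comp_chain C \<sigma> = foldl (\<lambda>w u. Comp C u w) (Ident C (fst \<sigma>)) (snd \<sigma>)"

definition degenerate :: "('o,'m) cat \<Rightarrow> ('o \<times> 'm list) \<Rightarrow> bool" where
  "degenerate C \<sigma> \<longleftrightarrow> (\<exists>u\<in>set (snd \<sigma>). u = Ident C (Dom C u))"

definition face :: "('o,'m) cat \<Rightarrow> nat \<Rightarrow> ('o \<times> 'm list) \<Rightarrow> ('o \<times> 'm list)" where
  "face C i \<sigma> = (let U = fst \<sigma>; us = snd \<sigma> in
     if i = 0 then (Cod C (hd us), tl us)
     else if i = length us then (U, butlast us)
     else (U, take (i - 1) us @ [Comp C (us ! i) (us ! (i - 1))] @ drop (i + 1) us))"

section \<open>The Gerstenhaber--Schack complex\<close>

text \<open>A component of bidegree (p,q): sigma |-> phi^sigma, a function of argument lists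
  [a_q, ..., a_1] (read as a_{q-1},...,a_0 in the Hochschild formula: the head of the list
  is the leftmost argument). A total cochain of degree n is a function p |-> component p,
  where component p has bidegree (p, n-p).\<close>

type_synonym ('o,'m,'a) cochn = "'o \<times> 'm list \<Rightarrow> 'a list \<Rightarrow> 'a"

definition lsum :: "('o,'m,'a,'r) tpsh \<Rightarrow> 'o \<Rightarrow> 'a list \<Rightarrow> 'a" where
  "lsum A V ts = foldr (padd A V) ts (pzero A V)"

definition fsig :: "('o,'m) cat \<Rightarrow> ('o,'m,'a,'r) tpsh \<Rightarrow> ('o \<times> 'm list) \<Rightarrow> 'a \<Rightarrow> 'a" where
  "fsig C A \<sigma> = pres A (comp_chain C \<sigma>)"

text \<open>Hochschild differential, componentwise; A(d sigma) is an A(c sigma)-bimodule via f^sigma.\<close>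
definition dHoch :: "('o,'m) cat \<Rightarrow> ('o,'m,'a,'k::comm_ring_1) tpsh \<Rightarrow> ('o,'m,'a) cochn
     \<Rightarrow> ('o \<times> 'm list) \<Rightarrow> 'a list \<Rightarrow> 'a" where
  "dHoch C A \<phi> \<sigma> xs = (let U = scod C \<sigma>; V = sdom \<sigma>; F = fsig C A \<sigma>; n = length xs - 1 in
     lsum A V ([pmul A V (F (hd xs)) (\<phi> \<sigma> (tl xs))] @
       map (\<lambda>i. psmult A V ((-1) ^ (i + 1))
                 (\<phi> \<sigma> (take i xs @ [pmul A U (xs ! i) (xs ! (i + 1))] @ drop (i + 2) xs))) [0..<n] @
       [psmult A V ((-1) ^ (n + 1)) (pmul A V (\<phi> \<sigma> (butlast xs)) (F (last xs)))]))"

definition dSimp :: "('o,'m) cat \<Rightarrow> ('o,'m,'a,'k::comm_ring_1) tpsh \<Rightarrow> ('o,'m,'a) cochn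
     \<Rightarrow> ('o \<times> 'm list) \<Rightarrow> 'a list \<Rightarrow> 'a" where
  "dSimp C A \<phi> \<sigma> xs = (let V = sdom \<sigma>; us = snd \<sigma> in
     lsum A V (map (\<lambda>i. psmult A V ((-1) ^ i)
        (if i = 0 then pres A (hd us) (\<phi> (face C 0 \<sigma>) xs)
         else if i = length us then \<phi> (face C i \<sigma>) (map (pres A (last us)) xs)
         else \<phi> (face C i \<sigma>) xs)) [0..<length us + 1]))"

text \<open>d_GS on total degree n: (-1)^(n+1) d_simp + d_Hoch; the result is a cochain of
  degree n+1 whose component p is d_Hoch(phi_p) + (-1)^(n+1) d_simp(phi_(p-1)).\<close>
definition dGS :: "('o,'m) cat \<Rightarrow> ('o,'m,'a,'k::comm_ring_1) tpsh \<Rightarrow> nat \<Rightarrow> (nat \<Rightarrow> ('o,'m,'a) cochn)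
     \<Rightarrow> nat \<Rightarrow> ('o,'m,'a) cochn" where
  "dGS C A n \<Phi> p \<sigma> xs = (let V = sdom \<sigma> in
     padd A V (if p \<le> n then dHoch C A (\<Phi> p) \<sigma> xs else pzero A V)
              (if 1 \<le> p then psmult A V ((-1) ^ (n + 1)) (dSimp C A (\<Phi> (p - 1)) \<sigma> xs) else pzero A V))"

definition args :: "('o,'m,'a,'r) tpsh \<Rightarrow> 'o \<Rightarrow> nat \<Rightarrow> 'a list set" where
  "args A U q = {xs. length xs = q \<and> set xs \<subseteq> pcar A U}"

text \<open>k-multilinear maps A(U)^q -> A(V) (elements of Hom_k(A(U)^{tensor q}, A(V))).\<close>
definition mlin :: "('o,'m,'a,'k) tpsh \<Rightarrow> 'o \<Rightarrow> 'o \<Rightarrow> nat \<Rightarrow> ('a list \<Rightarrow> 'a) \<Rightarrow> bool" where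
  "mlin A U V q \<phi> \<longleftrightarrow>
     (\<forall>xs\<in>args A U q. \<phi> xs \<in> pcar A V) \<and>
     (\<forall>xs\<in>args A U q. \<forall>i<q. \<forall>x\<in>pcar A U. \<forall>y\<in>pcar A U.
        \<phi> (xs[i := padd A U x y]) = padd A V (\<phi> (xs[i := x])) (\<phi> (xs[i := y]))) \<and>
     (\<forall>xs\<in>args A U q. \<forall>i<q. \<forall>x\<in>pcar A U. \<forall>r.
        \<phi> (xs[i := psmult A U r x]) = psmult A V r (\<phi> (xs[i := x])))"

definition cochain_pq :: "('o,'m) cat \<Rightarrow> ('o,'m,'a,'k) tpsh \<Rightarrow> nat \<Rightarrow> nat \<Rightarrow> ('o,'m,'a) cochn \<Rightarrow> bool" where
  "cochain_pq C A p q \<phi> \<longleftrightarrow> (\<forall>\<sigma>\<in>nerve C p. mlin A (scod C \<sigma>) (sdom \<sigma>) q (\<phi> \<sigma>))"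

definition cochain :: "('o,'m) cat \<Rightarrow> ('o,'m,'a,'k) tpsh \<Rightarrow> nat \<Rightarrow> (nat \<Rightarrow> ('o,'m,'a) cochn) \<Rightarrow> bool" where
  "cochain C A n \<Phi> \<longleftrightarrow> (\<forall>p\<le>n. cochain_pq C A p (n - p) (\<Phi> p))"

definition normalized :: "('o,'m) cat \<Rightarrow> ('o,'m,'a,'k) tpsh \<Rightarrow> nat \<Rightarrow> (nat \<Rightarrow> ('o,'m,'a) cochn) \<Rightarrow> bool" where
  "normalized C A n \<Phi> \<longleftrightarrow> (\<forall>p\<le>n. \<forall>\<sigma>\<in>nerve C p. \<forall>xs\<in>args A (scod C \<sigma>) (n - p).
      (\<exists>i<length xs. xs ! i = pone A (scod C \<sigma>)) \<longrightarrow> \<Phi> p \<sigma> xs = pzero A (sdom \<sigma>))"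

definition reduced :: "('o,'m) cat \<Rightarrow> ('o,'m,'a,'k) tpsh \<Rightarrow> nat \<Rightarrow> (nat \<Rightarrow> ('o,'m,'a) cochn) \<Rightarrow> bool" where
  "reduced C A n \<Phi> \<longleftrightarrow> (\<forall>p\<le>n. \<forall>\<sigma>\<in>nerve C p. degenerate C \<sigma> \<longrightarrow>
      (\<forall>xs\<in>args A (scod C \<sigma>) (n - p). \<Phi> p \<sigma> xs = pzero A (sdom \<sigma>)))"

text \<open>Phi in bar C'^n_GS(A) (normalized reduced cochains).\<close>
definition NR :: "('o,'m) cat \<Rightarrow> ('o,'m,'a,'k) tpsh \<Rightarrow> nat \<Rightarrow> (nat \<Rightarrow> ('o,'m,'a) cochn) \<Rightarrow> bool" where
  "NR C A n \<Phi> \<longleftrightarrow> cochain C A n \<Phi> \<and> normalized C A n \<Phi> \<and> reduced C A n \<Phi>"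

text \<open>Phi in bar C'^n_tGS(A) (normalized reduced, with q >= 1, i.e. the (n,0) component vanishes).\<close>
definition NRt :: "('o,'m) cat \<Rightarrow> ('o,'m,'a,'k) tpsh \<Rightarrow> nat \<Rightarrow> (nat \<Rightarrow> ('o,'m,'a) cochn) \<Rightarrow> bool" where
  "NRt C A n \<Phi> \<longleftrightarrow> NR C A n \<Phi> \<and> (\<forall>\<sigma>\<in>nerve C n. \<Phi> n \<sigma> [] = pzero A (sdom \<sigma>))"

definition ceq :: "('o,'m) cat \<Rightarrow> ('o,'m,'a,'k) tpsh \<Rightarrow> nat \<Rightarrow> (nat \<Rightarrow> ('o,'m,'a) cochn)
     \<Rightarrow> (nat \<Rightarrow> ('o,'m,'a) cochn) \<Rightarrow> bool" where
  "ceq C A n \<Phi> \<Psi> \<longleftrightarrow> (\<forall>p\<le>n. \<forall>\<sigma>\<in>nerve C p. \<forall>xs\<in>args A (scod C \<sigma>) (n - p). \<Phi> p \<sigma> xs = \<Psi> p \<sigma> xs)"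

definition czero1 :: "('o,'m,'a,'k) tpsh \<Rightarrow> ('o,'m,'a) cochn" where
  "czero1 A = (\<lambda>\<sigma> xs. pzero A (sdom \<sigma>))"

definition czero :: "('o,'m,'a,'k) tpsh \<Rightarrow> nat \<Rightarrow> ('o,'m,'a) cochn" where
  "czero A = (\<lambda>p. czero1 A)"

definition cneg :: "('o,'m,'a,'k::comm_ring_1) tpsh \<Rightarrow> ('o,'m,'a) cochn \<Rightarrow> ('o,'m,'a) cochn" where
  "cneg A \<phi> = (\<lambda>\<sigma> xs. psmult A (sdom \<sigma>) (-1) (\<phi> \<sigma> xs))"

definition csub :: "('o,'m,'a,'k::comm_ring_1) tpsh \<Rightarrow> (nat \<Rightarrow> ('o,'m,'a) cochn)
     \<Rightarrow> (nat \<Rightarrow> ('o,'m,'a) cochn) \<Rightarrow> nat \<Rightarrow> ('o,'m,'a) cochn" where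
  "csub A \<Phi> \<Psi> = (\<lambda>p \<sigma> xs. padd A (sdom \<sigma>) (\<Phi> p \<sigma> xs) (psmult A (sdom \<sigma>) (-1) (\<Psi> p \<sigma> xs)))"

text \<open>(a, b) in C^{0,1} + C^{1,0}, and (a, b, c) in C^{0,2} + C^{1,1} + C^{2,0}.\<close>
definition pack2 :: "('o,'m,'a) cochn \<Rightarrow> ('o,'m,'a) cochn \<Rightarrow> nat \<Rightarrow> ('o,'m,'a) cochn" where
  "pack2 a b = (\<lambda>p. if p = 0 then a else b)"

definition pack3 :: "('o,'m,'a) cochn \<Rightarrow> ('o,'m,'a) cochn \<Rightarrow> ('o,'m,'a) cochn \<Rightarrow> nat \<Rightarrow> ('o,'m,'a) cochn" where
  "pack3 a b c = (\<lambda>p. if p = 0 then a else if p = 1 then b else c)"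

section \<open>First order deformations\<close>

text \<open>(A[eps], m + m1 eps, f + f1 eps, 1 + c1 eps) as a family of k[eps]-algebras;
  a + b eps is the pair (a, b). m1^U = m1 at (U,[]), f1^u = f1 at (Dom u,[u]),
  c1^{u,v} = c1 at (Dom v,[v,u]).\<close>
definition deform :: "('o,'m) cat \<Rightarrow> ('o,'m,'a,'k::comm_ring_1) tpsh \<Rightarrow> ('o,'m,'a) cochn
     \<Rightarrow> ('o,'m,'a) cochn \<Rightarrow> ('o,'m,'a) cochn \<Rightarrow> ('o,'m,'a \<times> 'a,'k dual) tpsh" where
  "deform C A m1 f1 c1 = \<lparr>
     pcar = (\<lambda>U. pcar A U \<times> pcar A U),
     padd = (\<lambda>U (a, b) (a', b'). (padd A U a a', padd A U b b')),
     pzero = (\<lambda>U. (pzero A U, pzero A U)),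
     psmult = (\<lambda>U r (a, b). (psmult A U (re r) a, padd A U (psmult A U (re r) b) (psmult A U (eps r) a))),
     pmul = (\<lambda>U (a, b) (a', b'). (pmul A U a a',
               padd A U (padd A U (pmul A U a b') (pmul A U b a')) (m1 (U, []) [a, a']))),
     pone = (\<lambda>U. (pone A U, pzero A U)),
     pres = (\<lambda>u (a, b). (pres A u a, padd A (Dom C u) (pres A u b) (f1 (Dom C u, [u]) [a]))),
     ptw = (\<lambda>u v. (pone A (Dom C v), c1 (Dom C v, [v, u]) []))\<rparr>"

definition is_tw_deformation :: "('o,'m) cat \<Rightarrow> ('o,'m,'a,'k::comm_ring_1) tpsh \<Rightarrow> ('o,'m,'a) cochn
     \<Rightarrow> ('o,'m,'a) cochn \<Rightarrow> ('o,'m,'a) cochn \<Rightarrow> bool" where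
  "is_tw_deformation C A m1 f1 c1 \<longleftrightarrow>
     cochain_pq C A 0 2 m1 \<and> cochain_pq C A 1 1 f1 \<and> cochain_pq C A 2 0 c1 \<and>
     is_tw_presheaf C (deform C A m1 f1 c1)"

definition is_pr_deformation :: "('o,'m) cat \<Rightarrow> ('o,'m,'a,'k::comm_ring_1) tpsh \<Rightarrow> ('o,'m,'a) cochn
     \<Rightarrow> ('o,'m,'a) cochn \<Rightarrow> bool" where
  "is_pr_deformation C A m1 f1 \<longleftrightarrow> is_tw_deformation C A m1 f1 (czero1 A)"

text \<open>g = 1 + g1 eps and tau = 1 + tau1 eps.\<close>
definition g_of :: "('o,'m,'a,'k) tpsh \<Rightarrow> ('o,'m,'a) cochn \<Rightarrow> 'o \<Rightarrow> 'a \<times> 'a \<Rightarrow> 'a \<times> 'a" where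
  "g_of A g1 = (\<lambda>U (a, b). (a, padd A U b (g1 (U, []) [a])))"

definition tau_of :: "('o,'m) cat \<Rightarrow> ('o,'m,'a,'k) tpsh \<Rightarrow> ('o,'m,'a) cochn \<Rightarrow> 'm \<Rightarrow> 'a \<times> 'a" where
  "tau_of C A \<tau>1 = (\<lambda>u. (pone A (Dom C u), \<tau>1 (Dom C u, [u]) []))"

definition TwDefs :: "('o,'m) cat \<Rightarrow> ('o,'m,'a,'k::comm_ring_1) tpsh
     \<Rightarrow> (('o,'m,'a) cochn \<times> ('o,'m,'a) cochn \<times> ('o,'m,'a) cochn) set" where
  "TwDefs C A = {(m1, f1, c1). is_tw_deformation C A m1 f1 c1}"

definition tw_equiv :: "('o,'m) cat \<Rightarrow> ('o,'m,'a,'k::comm_ring_1) tpsh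
     \<Rightarrow> ((('o,'m,'a) cochn \<times> ('o,'m,'a) cochn \<times> ('o,'m,'a) cochn) \<times>
         (('o,'m,'a) cochn \<times> ('o,'m,'a) cochn \<times> ('o,'m,'a) cochn)) set" where
  "tw_equiv C A = {((m1, f1, c1), (m1', f1', c1')).
     (m1, f1, c1) \<in> TwDefs C A \<and> (m1', f1', c1') \<in> TwDefs C A \<and>
     (\<exists>g1 \<tau>1. cochain_pq C A 0 1 g1 \<and> cochain_pq C A 1 0 \<tau>1 \<and>
        is_tw_iso C (deform C A m1 f1 c1) (deform C A m1' f1' c1') (g_of A g1) (tau_of C A \<tau>1))}"

definition PrDefs :: "('o,'m) cat \<Rightarrow> ('o,'m,'a,'k::comm_ring_1) tpsh
     \<Rightarrow> (('o,'m,'a) cochn \<times> ('o,'m,'a) cochn) set" where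
  "PrDefs C A = {(m1, f1). is_pr_deformation C A m1 f1}"

definition pr_equiv :: "('o,'m) cat \<Rightarrow> ('o,'m,'a,'k::comm_ring_1) tpsh
     \<Rightarrow> ((('o,'m,'a) cochn \<times> ('o,'m,'a) cochn) \<times> (('o,'m,'a) cochn \<times> ('o,'m,'a) cochn)) set" where
  "pr_equiv C A = {((m1, f1), (m1', f1')).
     (m1, f1) \<in> PrDefs C A \<and> (m1', f1') \<in> PrDefs C A \<and>
     (\<exists>g1. cochain_pq C A 0 1 g1 \<and>
        is_pr_iso C (deform C A m1 f1 (czero1 A)) (deform C A m1' f1' (czero1 A)) (g_of A g1))}"

definition Z2 :: "('o,'m) cat \<Rightarrow> ('o,'m,'a,'k::comm_ring_1) tpsh
     \<Rightarrow> (('o,'m,'a) cochn \<times> ('o,'m,'a) cochn \<times> ('o,'m,'a) cochn) set" where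
  "Z2 C A = {(m1, f1, c1). NR C A 2 (pack3 m1 f1 c1) \<and>
                 ceq C A 3 (dGS C A 2 (pack3 m1 f1 c1)) (czero A)}"

text \<open>Cohomologous in bar C'_GS(A); H^2 bar C'_GS(A) = Z2 // cohrel.\<close>
definition cohrel :: "('o,'m) cat \<Rightarrow> ('o,'m,'a,'k::comm_ring_1) tpsh
     \<Rightarrow> ((('o,'m,'a) cochn \<times> ('o,'m,'a) cochn \<times> ('o,'m,'a) cochn) \<times>
         (('o,'m,'a) cochn \<times> ('o,'m,'a) cochn \<times> ('o,'m,'a) cochn)) set" where
  "cohrel C A = {((m1, f1, c1), (m1', f1', c1')).
     (m1, f1, c1) \<in> Z2 C A \<and> (m1', f1', c1') \<in> Z2 C A \<and>
     (\<exists>B. NR C A 1 B \<and> ceq C A 2 (dGS C A 1 B) (csub A (pack3 m1 f1 c1) (pack3 m1' f1' c1')))}"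

definition Z2t :: "('o,'m) cat \<Rightarrow> ('o,'m,'a,'k::comm_ring_1) tpsh
     \<Rightarrow> (('o,'m,'a) cochn \<times> ('o,'m,'a) cochn) set" where
  "Z2t C A = {(m1, f1). NRt C A 2 (pack3 m1 f1 (czero1 A)) \<and>
                 ceq C A 3 (dGS C A 2 (pack3 m1 f1 (czero1 A))) (czero A)}"

definition cohrel_t :: "('o,'m) cat \<Rightarrow> ('o,'m,'a,'k::comm_ring_1) tpsh
     \<Rightarrow> ((('o,'m,'a) cochn \<times> ('o,'m,'a) cochn) \<times> (('o,'m,'a) cochn \<times> ('o,'m,'a) cochn)) set" where
  "cohrel_t C A = {((m1, f1), (m1', f1')).
     (m1, f1) \<in> Z2t C A \<and> (m1', f1') \<in> Z2t C A \<and>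
     (\<exists>B. NRt C A 1 B \<and>
        ceq C A 2 (dGS C A 1 B) (csub A (pack3 m1 f1 (czero1 A)) (pack3 m1' f1' (czero1 A))))}"

end

theory Submission
  imports Defs "HOL-Algebra.Ring"
begin

text \<open>Write the elements of \<open>A(U)[\<epsilon>]\<close> as pairs \<open>a + b\<epsilon>\<close>. For a cochain \<open>(m1, f1, c1)\<close>
  each axiom of a twisted presheaf for \<open>(A[\<epsilon>], m + m1\<epsilon>, f + f1\<epsilon>, 1 + c1\<epsilon>)\<close> holds in the
  \<open>\<epsilon>\<close>-free part because \<open>A\<close> is a presheaf, and its \<open>\<epsilon>\<close>-part is linear in the cochain: the unit
  axioms say that the cochain is normalized and reduced, while associativity, multiplicativity of the
  restrictions, the twisted composition law and the cocycle law for the twists are exactly the four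
  components of \<open>d\<^sub>G\<^sub>S (m1, f1, c1) = 0\<close>; testing them on elements with vanishing
  \<open>\<epsilon>\<close>-part suffices. Likewise the axioms of a morphism \<open>(1 + g1\<epsilon>, 1 + \<tau>1\<epsilon>)\<close> are the
  components of \<open>d\<^sub>G\<^sub>S (g1, -\<tau>1) = (m1, f1, c1) - (m1', f1', c1')\<close>, invertibility being
  automatic. So the 2-cocycles are precisely the deformations and cohomologous cocycles are precisely
  equivalent deformations, which makes the identity on classes the required bijection; presheaf
  deformations are the case \<open>c1 = 0\<close>.\<close>

definition ring_of :: "('o,'m,'a,'k) tpsh \<Rightarrow> 'o \<Rightarrow> 'a ring" where
  "ring_of T U = \<lparr>carrier = pcar T U, monoid.mult = pmul T U, one = pone T U, zero = pzero T U,
     add = padd T U\<rparr>"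

lemma ring_of_simps:
  "pcar T U = carrier (ring_of T U)"
  "padd T U x y = x \<oplus>\<^bsub>ring_of T U\<^esub> y"
  "pmul T U x y = x \<otimes>\<^bsub>ring_of T U\<^esub> y"
  "pzero T U = \<zero>\<^bsub>ring_of T U\<^esub>"
  "pone T U = \<one>\<^bsub>ring_of T U\<^esub>"
  by (simp_all add: ring_of_def)

lemma is_algebra_ring:
  assumes "is_algebra T U"
  shows "ring (ring_of T U)"
  using assms unfolding is_algebra_def Let_def
  by (elim conjE) (intro ringI abelian_groupI monoidI; unfold ring_of_simps[symmetric]; (blast | metis))

lemma is_algebra_mult_assoc:
  "is_algebra T U \<Longrightarrow> a \<in> pcar T U \<Longrightarrow> b \<in> pcar T U \<Longrightarrow> c \<in> pcar T U \<Longrightarrow>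
    pmul T U (pmul T U a b) c = pmul T U a (pmul T U b c)"
  unfolding is_algebra_def Let_def by simp

lemma is_algebra_mult_one:
  "is_algebra T U \<Longrightarrow> a \<in> pcar T U \<Longrightarrow> pmul T U (pone T U) a = a \<and> pmul T U a (pone T U) = a"
  unfolding is_algebra_def Let_def by simp

lemma is_algebra_smult:
  assumes "is_algebra T U" and "a \<in> pcar T U" "b \<in> pcar T U"
  shows "psmult T U r a \<in> pcar T U"
    and "psmult T U (r + s) a = padd T U (psmult T U r a) (psmult T U s a)"
    and "psmult T U r (padd T U a b) = padd T U (psmult T U r a) (psmult T U r b)"
    and "psmult T U (r * s) a = psmult T U r (psmult T U s a)"
    and "psmult T U 1 a = a"
    and "pmul T U (psmult T U r a) b = psmult T U r (pmul T U a b)"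
    and "pmul T U a (psmult T U r b) = psmult T U r (pmul T U a b)"
  using assms unfolding is_algebra_def Let_def by simp_all

lemma is_algebra_smult_zero_neg:
  fixes T :: "('o,'m,'a,'k::comm_ring_1) tpsh"
  assumes alg: "is_algebra T U" and a: "a \<in> carrier (ring_of T U)"
  shows "psmult T U 0 a = \<zero>\<^bsub>ring_of T U\<^esub>"
    and "psmult T U (-1) a = \<ominus>\<^bsub>ring_of T U\<^esub> a"
proof -
  interpret r: ring "ring_of T U" using is_algebra_ring[OF alg] .
  note sm = is_algebra_smult[OF alg, unfolded ring_of_simps]
  have sm_closed: "psmult T U s a \<in> carrier (ring_of T U)" for s
    using sm(1) a by blast
  have "psmult T U (0 + 0) a = psmult T U 0 a \<oplus>\<^bsub>ring_of T U\<^esub> psmult T U 0 a"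
    using sm(2) a by blast
  then show zero: "psmult T U 0 a = \<zero>\<^bsub>ring_of T U\<^esub>"
    using sm_closed by (metis r.add.l_cancel_one r.add.r_cancel_one' add_0)
  have "psmult T U (1 + -1) a = a \<oplus>\<^bsub>ring_of T U\<^esub> psmult T U (-1) a"
    using sm(2,5) a by (metis (no_types))
  then show "psmult T U (-1) a = \<ominus>\<^bsub>ring_of T U\<^esub> a"
    using zero sm_closed a by (metis r.add.inv_comm r.minus_equality r.add.m_comm add.right_inverse)
qed

lemma is_algebra_smult_zero_right:
  fixes T :: "('o,'m,'a,'k::comm_ring_1) tpsh"
  assumes alg: "is_algebra T U"
  shows "psmult T U r \<zero>\<^bsub>ring_of T U\<^esub> = \<zero>\<^bsub>ring_of T U\<^esub>"
proof -
  interpret r: ring "ring_of T U" using is_algebra_ring[OF alg] .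
  have zero: "psmult T U 0 \<zero>\<^bsub>ring_of T U\<^esub> = \<zero>\<^bsub>ring_of T U\<^esub>"
    using is_algebra_smult_zero_neg(1)[OF alg r.zero_closed] .
  have "psmult T U r (psmult T U 0 \<zero>\<^bsub>ring_of T U\<^esub>) = psmult T U (r * 0) \<zero>\<^bsub>ring_of T U\<^esub>"
    using is_algebra_smult(4)[OF alg, unfolded ring_of_simps, OF r.zero_closed r.zero_closed, of r 0] by simp
  then show ?thesis using zero by simp
qed

lemma (in ring) add_neg_eq_zero_iff:
  "x \<in> carrier R \<Longrightarrow> y \<in> carrier R \<Longrightarrow> (x \<oplus> \<ominus> y = \<zero>) = (x = y)"
  by (metis add.inv_closed minus_equality minus_minus r_neg)

lemma (in ring) eq_diff_if_add_eq:
  assumes "x \<oplus> y = z" and "x \<in> carrier R" "y \<in> carrier R"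
  shows "y = z \<oplus> \<ominus> x"
proof -
  have "y = (x \<oplus> y) \<oplus> \<ominus> x" using assms(2,3) by algebra
  then show ?thesis by (simp add: assms(1))
qed

lemma (in ring) add_left_cancel_iff:
  "b \<in> carrier R \<Longrightarrow> x \<in> carrier R \<Longrightarrow> y \<in> carrier R \<Longrightarrow> (b \<oplus> x = b \<oplus> y) = (x = y)"
  by (metis add.right_cancel a_comm)

lemma (in ring) diff_eq_diff_iff:
  assumes c: "x \<in> carrier R" "y \<in> carrier R" "z \<in> carrier R" "w \<in> carrier R"
  shows "(x \<oplus> \<ominus> y = z \<oplus> \<ominus> w) = (x \<oplus> w = z \<oplus> y)"
proof -
  have "(x \<oplus> \<ominus> y = z \<oplus> \<ominus> w) = ((x \<oplus> \<ominus> y) \<oplus> (y \<oplus> w) = (z \<oplus> \<ominus> w) \<oplus> (y \<oplus> w))"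
    using c by (simp add: add.right_cancel)
  also have "\<dots> = (x \<oplus> w = z \<oplus> y)"
  proof -
    have "(x \<oplus> \<ominus> y) \<oplus> (y \<oplus> w) = x \<oplus> w" "(z \<oplus> \<ominus> w) \<oplus> (y \<oplus> w) = z \<oplus> y" using c by algebra+
    then show ?thesis by simp
  qed
  finally show ?thesis .
qed

lemma all_less_1: "(\<forall>i<(1::nat). P i) \<longleftrightarrow> P 0"
  by auto

lemma all_less_2: "(\<forall>i<(2::nat). P i) \<longleftrightarrow> P 0 \<and> P 1"
  by (auto simp: eval_nat_numeral less_Suc_eq)

lemma all_le_1: "(\<forall>i\<le>(1::nat). P i) \<longleftrightarrow> P 0 \<and> P 1"
  by (auto simp: le_Suc_eq)

lemma all_le_2: "(\<forall>i\<le>(2::nat). P i) \<longleftrightarrow> P 0 \<and> P 1 \<and> P 2"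
  by (auto simp: eval_nat_numeral le_Suc_eq)

lemma all_le_3: "(\<forall>i\<le>(3::nat). P i) \<longleftrightarrow> P 0 \<and> P 1 \<and> P 2 \<and> P 3"
  by (auto simp: eval_nat_numeral le_Suc_eq)

lemma ex_less_Suc_0: "(\<exists>i<Suc 0. P i) = P 0"
  by auto

lemma ex_less_2: "(\<exists>i<Suc (Suc 0). P i) = (P 0 \<or> P (Suc 0))"
  by (auto simp: less_Suc_eq)

lemma ball_Times_iff_ball_fst:
  assumes "\<And>a b. a \<in> S \<Longrightarrow> b \<in> T \<Longrightarrow> P (a, b) \<longleftrightarrow> Q a" and "t \<in> T"
  shows "(\<forall>x\<in>S \<times> T. P x) \<longleftrightarrow> (\<forall>a\<in>S. Q a)"
  using assms by fastforce

lemma scod_simps[simp]: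
  "scod C (U, []) = U" "scod C (V, [u]) = Cod C u" "scod C (W, [v, u]) = Cod C u"
  "scod C (X, [w, v, u]) = Cod C u" "sdom (Y, us) = Y"
  by (simp_all add: scod_def sdom_def)

locale small_category =
  fixes C :: "('o,'m) cat"
  assumes is_category: "is_category C"
begin

lemmas category_axioms = is_category[unfolded is_category_def]

lemma dom_ob[simp]: "u \<in> Mor C \<Longrightarrow> Dom C u \<in> Ob C"
  and cod_ob[simp]: "u \<in> Mor C \<Longrightarrow> Cod C u \<in> Ob C"
  and ident_mor[simp]: "U \<in> Ob C \<Longrightarrow> Ident C U \<in> Mor C"
  and ident_dom[simp]: "U \<in> Ob C \<Longrightarrow> Dom C (Ident C U) = U"
  and ident_cod[simp]: "U \<in> Ob C \<Longrightarrow> Cod C (Ident C U) = U"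
  and comp_mor[simp]: "u \<in> Mor C \<Longrightarrow> v \<in> Mor C \<Longrightarrow> Cod C v = Dom C u \<Longrightarrow> Comp C u v \<in> Mor C"
  and comp_dom[simp]: "u \<in> Mor C \<Longrightarrow> v \<in> Mor C \<Longrightarrow> Cod C v = Dom C u \<Longrightarrow> Dom C (Comp C u v) = Dom C v"
  and comp_cod[simp]: "u \<in> Mor C \<Longrightarrow> v \<in> Mor C \<Longrightarrow> Cod C v = Dom C u \<Longrightarrow> Cod C (Comp C u v) = Cod C u"
  and comp_ident_right[simp]: "u \<in> Mor C \<Longrightarrow> Comp C u (Ident C (Dom C u)) = u"
  and comp_ident_left[simp]: "u \<in> Mor C \<Longrightarrow> Comp C (Ident C (Cod C u)) u = u"
  by (use category_axioms in blast)+

lemma nerve0_iff: "(U, us) \<in> nerve C 0 \<longleftrightarrow> us = [] \<and> U \<in> Ob C"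
  unfolding nerve_def by auto

lemma nerve1_iff: "(U, us) \<in> nerve C 1 \<longleftrightarrow> (\<exists>u. us = [u] \<and> u \<in> Mor C \<and> U = Dom C u)"
  unfolding nerve_def by (auto simp: length_Suc_conv)

lemma nerve2_iff: "(U, us) \<in> nerve C 2 \<longleftrightarrow>
   (\<exists>u v. us = [v, u] \<and> u \<in> Mor C \<and> v \<in> Mor C \<and> Cod C v = Dom C u \<and> U = Dom C v)"
proof
  assume "(U, us) \<in> nerve C 2"
  then have l: "length us = 2" and s: "set us \<subseteq> Mor C"
    and d: "\<forall>i<length us. Dom C (us ! i) = (if i = 0 then U else Cod C (us ! (i - 1)))"
    unfolding nerve_def by auto
  from l obtain v u where us: "us = [v, u]" by (auto simp: numeral_2_eq_2 length_Suc_conv)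
  show "\<exists>u v. us = [v, u] \<and> u \<in> Mor C \<and> v \<in> Mor C \<and> Cod C v = Dom C u \<and> U = Dom C v"
    using us s d[rule_format, of 0] d[rule_format, of 1] by auto
next
  assume "\<exists>u v. us = [v, u] \<and> u \<in> Mor C \<and> v \<in> Mor C \<and> Cod C v = Dom C u \<and> U = Dom C v"
  then show "(U, us) \<in> nerve C 2" unfolding nerve_def by (auto simp: less_Suc_eq)
qed

lemma nerve3_iff: "(U, us) \<in> nerve C 3 \<longleftrightarrow>
   (\<exists>u v w. us = [w, v, u] \<and> u \<in> Mor C \<and> v \<in> Mor C \<and> w \<in> Mor C \<and>
      Cod C v = Dom C u \<and> Cod C w = Dom C v \<and> U = Dom C w)"
proof
  assume "(U, us) \<in> nerve C 3"
  then have l: "length us = 3" and s: "set us \<subseteq> Mor C"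
    and d: "\<forall>i<length us. Dom C (us ! i) = (if i = 0 then U else Cod C (us ! (i - 1)))"
    unfolding nerve_def by auto
  from l obtain w v u where us: "us = [w, v, u]" by (auto simp: numeral_3_eq_3 length_Suc_conv)
  show "\<exists>u v w. us = [w, v, u] \<and> u \<in> Mor C \<and> v \<in> Mor C \<and> w \<in> Mor C \<and>
      Cod C v = Dom C u \<and> Cod C w = Dom C v \<and> U = Dom C w"
    using us s d[rule_format, of 0] d[rule_format, of 1] d[rule_format, of 2] by auto
next
  assume "\<exists>u v w. us = [w, v, u] \<and> u \<in> Mor C \<and> v \<in> Mor C \<and> w \<in> Mor C \<and>
      Cod C v = Dom C u \<and> Cod C w = Dom C v \<and> U = Dom C w"
  then show "(U, us) \<in> nerve C 3" unfolding nerve_def by (auto simp: less_Suc_eq)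
qed

lemma ball_nerve0: "(\<forall>\<sigma>\<in>nerve C 0. P \<sigma>) \<longleftrightarrow> (\<forall>U\<in>Ob C. P (U, []))"
  unfolding Ball_def split_paired_All by (auto simp: nerve0_iff)

lemma ball_nerve1: "(\<forall>\<sigma>\<in>nerve C 1. P \<sigma>) \<longleftrightarrow> (\<forall>u\<in>Mor C. P (Dom C u, [u]))"
  unfolding Ball_def split_paired_All by (auto simp: nerve1_iff nerve1_iff[unfolded One_nat_def])

lemmas ball_nerve_Suc_0 = ball_nerve1[unfolded One_nat_def]

lemma ball_nerve2: "(\<forall>\<sigma>\<in>nerve C 2. P \<sigma>) \<longleftrightarrow>
   (\<forall>u\<in>Mor C. \<forall>v\<in>Mor C. Cod C v = Dom C u \<longrightarrow> P (Dom C v, [v, u]))"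
  unfolding Ball_def split_paired_All by (auto simp: nerve2_iff)

lemma ball_nerve3: "(\<forall>\<sigma>\<in>nerve C 3. P \<sigma>) \<longleftrightarrow>
   (\<forall>u\<in>Mor C. \<forall>v\<in>Mor C. \<forall>w\<in>Mor C. Cod C v = Dom C u \<longrightarrow> Cod C w = Dom C v \<longrightarrow>
      P (Dom C w, [w, v, u]))"
  unfolding Ball_def split_paired_All by (auto simp: nerve3_iff)

end

lemma ball_args0: "(\<forall>xs\<in>args A U 0. P xs) \<longleftrightarrow> P []"
  unfolding args_def by auto

lemma ball_args1: "(\<forall>xs\<in>args A U 1. P xs) \<longleftrightarrow> (\<forall>a\<in>carrier (ring_of A U). P [a])"
  unfolding args_def ring_of_simps by (auto simp: length_Suc_conv)

lemmas ball_args_Suc_0 = ball_args1[unfolded One_nat_def]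

lemma ball_args2: "(\<forall>xs\<in>args A U 2. P xs) \<longleftrightarrow>
   (\<forall>a\<in>carrier (ring_of A U). \<forall>b\<in>carrier (ring_of A U). P [a, b])"
  unfolding args_def ring_of_simps by (auto simp: length_Suc_conv numeral_2_eq_2)

lemma ball_args3: "(\<forall>xs\<in>args A U 3. P xs) \<longleftrightarrow>
   (\<forall>a\<in>carrier (ring_of A U). \<forall>b\<in>carrier (ring_of A U). \<forall>c\<in>carrier (ring_of A U). P [a, b, c])"
  unfolding args_def ring_of_simps by (auto simp: length_Suc_conv numeral_3_eq_3)

lemma mlin0: "mlin A U V 0 \<phi> \<longleftrightarrow> \<phi> [] \<in> carrier (ring_of A V)"
  unfolding mlin_def ball_args0 by (simp add: ring_of_simps)

lemma mlin1: "mlin A U V 1 \<phi> \<longleftrightarrow>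
   (\<forall>a\<in>carrier (ring_of A U). \<phi> [a] \<in> carrier (ring_of A V)) \<and>
   (\<forall>a\<in>carrier (ring_of A U). \<forall>b\<in>carrier (ring_of A U).
      \<phi> [a \<oplus>\<^bsub>ring_of A U\<^esub> b] = \<phi> [a] \<oplus>\<^bsub>ring_of A V\<^esub> \<phi> [b]) \<and>
   (\<forall>a\<in>carrier (ring_of A U). \<forall>r. \<phi> [psmult A U r a] = psmult A V r (\<phi> [a]))"
  unfolding mlin_def ball_args1 all_less_1 by (auto simp: ring_of_simps)

lemma mlin2: "mlin A U V 2 \<phi> \<longleftrightarrow>
   (\<forall>a\<in>carrier (ring_of A U). \<forall>b\<in>carrier (ring_of A U). \<phi> [a, b] \<in> carrier (ring_of A V)) \<and>
   (\<forall>a\<in>carrier (ring_of A U). \<forall>b\<in>carrier (ring_of A U). \<forall>c\<in>carrier (ring_of A U).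
       \<phi> [a \<oplus>\<^bsub>ring_of A U\<^esub> b, c] = \<phi> [a, c] \<oplus>\<^bsub>ring_of A V\<^esub> \<phi> [b, c] \<and>
       \<phi> [c, a \<oplus>\<^bsub>ring_of A U\<^esub> b] = \<phi> [c, a] \<oplus>\<^bsub>ring_of A V\<^esub> \<phi> [c, b]) \<and>
   (\<forall>a\<in>carrier (ring_of A U). \<forall>b\<in>carrier (ring_of A U). \<forall>r.
       \<phi> [psmult A U r a, b] = psmult A V r (\<phi> [a, b]) \<and>
       \<phi> [b, psmult A U r a] = psmult A V r (\<phi> [b, a]))"
  unfolding mlin_def ball_args2 all_less_2 by (auto simp: ring_of_simps)

lemma alg_map_multD:
  "alg_map T U T' V h \<Longrightarrow> a \<in> pcar T U \<Longrightarrow> b \<in> pcar T U \<Longrightarrow> h (pmul T U a b) = pmul T' V (h a) (h b)"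
  unfolding alg_map_def by blast

lemma alg_map_oneD: "alg_map T U T' V h \<Longrightarrow> h (pone T U) = pone T' V"
  unfolding alg_map_def by blast

lemma alg_mapI:
  assumes "\<And>a. a \<in> pcar T U \<Longrightarrow> h a \<in> pcar T' V"
    and "\<And>a b. a \<in> pcar T U \<Longrightarrow> b \<in> pcar T U \<Longrightarrow> h (padd T U a b) = padd T' V (h a) (h b)"
    and "\<And>r a. a \<in> pcar T U \<Longrightarrow> h (psmult T U r a) = psmult T' V r (h a)"
    and "\<And>a b. a \<in> pcar T U \<Longrightarrow> b \<in> pcar T U \<Longrightarrow> h (pmul T U a b) = pmul T' V (h a) (h b)"
    and "h (pone T U) = pone T' V"
  shows "alg_map T U T' V h"
  unfolding alg_map_def using assms by blast

lemma dual_simps[simp]: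
  "re (x + y) = re x + re y" "eps (x + y) = eps x + eps y"
  "re (x * y) = re x * re y" "eps (x * y) = re x * eps y + eps x * re y"
  "re (1::'k::comm_ring_1 dual) = 1" "eps (1::'k::comm_ring_1 dual) = 0"
  by (simp_all add: plus_dual_def times_dual_def one_dual_def)

lemmas dGS_expand = dGS_def dHoch_def dSimp_def face_def Let_def fsig_def comp_chain_def lsum_def
  ring_of_simps eval_nat_numeral upt_rec

locale gs_presheaf = small_category C
  for C :: "('o,'m) cat" +
  fixes A :: "('o,'m,'a,'k::comm_ring_1) tpsh"
  assumes is_presheaf: "is_presheaf C A"
begin

abbreviation R :: "'o \<Rightarrow> 'a ring" where "R U \<equiv> ring_of A U"

lemma is_algebra: "U \<in> Ob C \<Longrightarrow> is_algebra A U"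
  using is_presheaf unfolding is_presheaf_def by blast

lemma ring_R: "U \<in> Ob C \<Longrightarrow> ring (R U)"
  using is_algebra_ring[OF is_algebra] .

lemma R_zero_closed[simp]: "U \<in> Ob C \<Longrightarrow> \<zero>\<^bsub>R U\<^esub> \<in> carrier (R U)"
  and R_one_closed[simp]: "U \<in> Ob C \<Longrightarrow> \<one>\<^bsub>R U\<^esub> \<in> carrier (R U)"
  by (simp_all add: ring.ring_simprules(2,6)[OF ring_R])

lemma smult_closed[simp]: "U \<in> Ob C \<Longrightarrow> x \<in> carrier (R U) \<Longrightarrow> psmult A U r x \<in> carrier (R U)"
  and smult_one[simp]: "U \<in> Ob C \<Longrightarrow> x \<in> carrier (R U) \<Longrightarrow> psmult A U 1 x = x"
  and smult_add_left: "U \<in> Ob C \<Longrightarrow> x \<in> carrier (R U) \<Longrightarrow>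
    psmult A U (r + s) x = psmult A U r x \<oplus>\<^bsub>R U\<^esub> psmult A U s x"
  and smult_add_right: "U \<in> Ob C \<Longrightarrow> x \<in> carrier (R U) \<Longrightarrow> y \<in> carrier (R U) \<Longrightarrow>
    psmult A U r (x \<oplus>\<^bsub>R U\<^esub> y) = psmult A U r x \<oplus>\<^bsub>R U\<^esub> psmult A U r y"
  and smult_smult: "U \<in> Ob C \<Longrightarrow> x \<in> carrier (R U) \<Longrightarrow>
    psmult A U (r * s) x = psmult A U r (psmult A U s x)"
  and smult_mult_left: "U \<in> Ob C \<Longrightarrow> x \<in> carrier (R U) \<Longrightarrow> y \<in> carrier (R U) \<Longrightarrow>
    psmult A U r x \<otimes>\<^bsub>R U\<^esub> y = psmult A U r (x \<otimes>\<^bsub>R U\<^esub> y)"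
  and smult_mult_right: "U \<in> Ob C \<Longrightarrow> x \<in> carrier (R U) \<Longrightarrow> y \<in> carrier (R U) \<Longrightarrow>
    x \<otimes>\<^bsub>R U\<^esub> psmult A U r y = psmult A U r (x \<otimes>\<^bsub>R U\<^esub> y)"
  by (simp_all add: is_algebra_smult[OF is_algebra, unfolded ring_of_simps])

lemma smult_zero_left[simp]: "U \<in> Ob C \<Longrightarrow> x \<in> carrier (R U) \<Longrightarrow> psmult A U 0 x = \<zero>\<^bsub>R U\<^esub>"
  and smult_minus_one[simp]: "U \<in> Ob C \<Longrightarrow> x \<in> carrier (R U) \<Longrightarrow> psmult A U (-1) x = \<ominus>\<^bsub>R U\<^esub> x"
  and smult_zero_right[simp]: "U \<in> Ob C \<Longrightarrow> psmult A U r \<zero>\<^bsub>R U\<^esub> = \<zero>\<^bsub>R U\<^esub>"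
  by (simp_all add: is_algebra_smult_zero_neg[OF is_algebra] is_algebra_smult_zero_right[OF is_algebra])

lemma smult_neg: "U \<in> Ob C \<Longrightarrow> x \<in> carrier (R U) \<Longrightarrow>
    psmult A U r (\<ominus>\<^bsub>R U\<^esub> x) = \<ominus>\<^bsub>R U\<^esub> psmult A U r x"
  by (metis mult.commute smult_minus_one smult_smult smult_closed)

lemmas smult_laws = smult_add_left smult_add_right smult_smult smult_mult_left smult_mult_right smult_neg

lemma restriction_alg_map: "u \<in> Mor C \<Longrightarrow> alg_map A (Cod C u) A (Dom C u) (pres A u)"
  using is_presheaf unfolding is_presheaf_def by blast

lemma pres_closed[simp]: "u \<in> Mor C \<Longrightarrow> a \<in> carrier (R (Cod C u)) \<Longrightarrow> pres A u a \<in> carrier (R (Dom C u))"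
  and pres_add[simp]: "u \<in> Mor C \<Longrightarrow> a \<in> carrier (R (Cod C u)) \<Longrightarrow> b \<in> carrier (R (Cod C u)) \<Longrightarrow>
      pres A u (a \<oplus>\<^bsub>R (Cod C u)\<^esub> b) = pres A u a \<oplus>\<^bsub>R (Dom C u)\<^esub> pres A u b"
  and pres_mult[simp]: "u \<in> Mor C \<Longrightarrow> a \<in> carrier (R (Cod C u)) \<Longrightarrow> b \<in> carrier (R (Cod C u)) \<Longrightarrow>
      pres A u (a \<otimes>\<^bsub>R (Cod C u)\<^esub> b) = pres A u a \<otimes>\<^bsub>R (Dom C u)\<^esub> pres A u b"
  and pres_smult[simp]: "u \<in> Mor C \<Longrightarrow> a \<in> carrier (R (Cod C u)) \<Longrightarrow>
      pres A u (psmult A (Cod C u) r a) = psmult A (Dom C u) r (pres A u a)"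
  and pres_one[simp]: "u \<in> Mor C \<Longrightarrow> pres A u \<one>\<^bsub>R (Cod C u)\<^esub> = \<one>\<^bsub>R (Dom C u)\<^esub>"
  by (use restriction_alg_map in \<open>auto simp: alg_map_def ring_of_simps\<close>)+

lemma pres_zero[simp]: "u \<in> Mor C \<Longrightarrow> pres A u \<zero>\<^bsub>R (Cod C u)\<^esub> = \<zero>\<^bsub>R (Dom C u)\<^esub>"
  by (metis R_one_closed cod_ob dom_ob pres_closed pres_smult smult_zero_left)

lemma pres_neg[simp]: "u \<in> Mor C \<Longrightarrow> a \<in> carrier (R (Cod C u)) \<Longrightarrow>
      pres A u (\<ominus>\<^bsub>R (Cod C u)\<^esub> a) = \<ominus>\<^bsub>R (Dom C u)\<^esub> pres A u a"
  by (metis cod_ob dom_ob pres_closed pres_smult smult_minus_one)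

text \<open>The same rules with the codomain abstracted, so that they fire on terms whose
  codomain has already been simplified to another object.\<close>

lemma pres_closed'[simp]: "u \<in> Mor C \<Longrightarrow> Cod C u = U \<Longrightarrow> a \<in> carrier (R U) \<Longrightarrow>
      pres A u a \<in> carrier (R (Dom C u))"
  and pres_add'[simp]: "u \<in> Mor C \<Longrightarrow> Cod C u = U \<Longrightarrow> a \<in> carrier (R U) \<Longrightarrow> b \<in> carrier (R U) \<Longrightarrow>
      pres A u (a \<oplus>\<^bsub>R U\<^esub> b) = pres A u a \<oplus>\<^bsub>R (Dom C u)\<^esub> pres A u b"
  and pres_mult'[simp]: "u \<in> Mor C \<Longrightarrow> Cod C u = U \<Longrightarrow> a \<in> carrier (R U) \<Longrightarrow> b \<in> carrier (R U) \<Longrightarrow>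
      pres A u (a \<otimes>\<^bsub>R U\<^esub> b) = pres A u a \<otimes>\<^bsub>R (Dom C u)\<^esub> pres A u b"
  and pres_smult'[simp]: "u \<in> Mor C \<Longrightarrow> Cod C u = U \<Longrightarrow> a \<in> carrier (R U) \<Longrightarrow>
      pres A u (psmult A U r a) = psmult A (Dom C u) r (pres A u a)"
  and pres_one'[simp]: "u \<in> Mor C \<Longrightarrow> Cod C u = U \<Longrightarrow> pres A u \<one>\<^bsub>R U\<^esub> = \<one>\<^bsub>R (Dom C u)\<^esub>"
  and pres_zero'[simp]: "u \<in> Mor C \<Longrightarrow> Cod C u = U \<Longrightarrow> pres A u \<zero>\<^bsub>R U\<^esub> = \<zero>\<^bsub>R (Dom C u)\<^esub>"
  and pres_neg'[simp]: "u \<in> Mor C \<Longrightarrow> Cod C u = U \<Longrightarrow> a \<in> carrier (R U) \<Longrightarrow>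
      pres A u (\<ominus>\<^bsub>R U\<^esub> a) = \<ominus>\<^bsub>R (Dom C u)\<^esub> pres A u a"
  by auto

lemma pres_ident[simp]: "U \<in> Ob C \<Longrightarrow> a \<in> carrier (R U) \<Longrightarrow> pres A (Ident C U) a = a"
  using is_presheaf unfolding is_presheaf_def ring_of_simps by blast

lemma pres_comp: "u \<in> Mor C \<Longrightarrow> v \<in> Mor C \<Longrightarrow> Cod C v = Dom C u \<Longrightarrow> a \<in> carrier (R (Cod C u)) \<Longrightarrow>
   pres A (Comp C u v) a = pres A v (pres A u a)"
  using is_presheaf unfolding is_presheaf_def ring_of_simps by blast

lemma cochain_pq0_iff: "cochain_pq C A 0 q \<phi> \<longleftrightarrow> (\<forall>U\<in>Ob C. mlin A U U q (\<phi> (U, [])))"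
  unfolding cochain_pq_def ball_nerve0 by simp

lemma cochain_pq1_iff: "cochain_pq C A 1 q \<phi> \<longleftrightarrow>
   (\<forall>u\<in>Mor C. mlin A (Cod C u) (Dom C u) q (\<phi> (Dom C u, [u])))"
  unfolding cochain_pq_def ball_nerve1 by simp

lemma cochain_pq2_iff: "cochain_pq C A 2 q \<phi> \<longleftrightarrow> (\<forall>u\<in>Mor C. \<forall>v\<in>Mor C. Cod C v = Dom C u \<longrightarrow>
     mlin A (Cod C u) (Dom C v) q (\<phi> (Dom C v, [v, u])))"
  unfolding cochain_pq_def ball_nerve2 by simp

lemma cochain_pack2_iff: "cochain C A 1 (pack2 g t) \<longleftrightarrow> cochain_pq C A 0 1 g \<and> cochain_pq C A 1 0 t"
  unfolding cochain_def all_le_1 pack2_def by simp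

lemma cochain_pack3_iff: "cochain C A 2 (pack3 m1 f1 c1) \<longleftrightarrow>
   cochain_pq C A 0 2 m1 \<and> cochain_pq C A 1 1 f1 \<and> cochain_pq C A 2 0 c1"
  unfolding cochain_def all_le_2 pack3_def by simp

lemma mlin1D:
  assumes "mlin A U V 1 \<phi>" "U \<in> Ob C" "V \<in> Ob C"
  shows "a \<in> carrier (R U) \<Longrightarrow> \<phi> [a] \<in> carrier (R V)"
    "a \<in> carrier (R U) \<Longrightarrow> b \<in> carrier (R U) \<Longrightarrow> \<phi> [a
      \<oplus>\<^bsub>R U\<^esub> b] = \<phi> [a] \<oplus>\<^bsub>R V\<^esub> \<phi> [b]"
    "a \<in> carrier (R U) \<Longrightarrow> \<phi> [psmult A U r a] = psmult A V r (\<phi> [a])"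
    "a \<in> carrier (R U) \<Longrightarrow> \<phi> [\<ominus>\<^bsub>R U\<^esub> a] = \<ominus>\<^bsub>R V\<^esub> \<phi> [a]"
    "\<phi> [\<zero>\<^bsub>R U\<^esub>] = \<zero>\<^bsub>R V\<^esub>"
proof -
  note h = assms(1)[unfolded mlin1]
  show c: "a \<in> carrier (R U) \<Longrightarrow> \<phi> [a] \<in> carrier (R V)" for a using h by blast
  show "a \<in> carrier (R U) \<Longrightarrow> b \<in> carrier (R U) \<Longrightarrow> \<phi> [a
    \<oplus>\<^bsub>R U\<^esub> b] = \<phi> [a] \<oplus>\<^bsub>R V\<^esub> \<phi> [b]"
    using h by blast
  show s: "a \<in> carrier (R U) \<Longrightarrow> \<phi> [psmult A U r a] = psmult A V r (\<phi> [a])" for a r using h by blast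
  show "a \<in> carrier (R U) \<Longrightarrow> \<phi> [\<ominus>\<^bsub>R U\<^esub> a] = \<ominus>\<^bsub>R V\<^esub> \<phi> [a]"
    using s[of a "-1"] c[of a] assms(2,3) by simp
  show "\<phi> [\<zero>\<^bsub>R U\<^esub>] = \<zero>\<^bsub>R V\<^esub>"
    using s[of "\<zero>\<^bsub>R U\<^esub>" 0] c[of "\<zero>\<^bsub>R U\<^esub>"] assms(2,3) by simp
qed

lemma mlin2D:
  assumes "mlin A U V 2 \<phi>" "U \<in> Ob C" "V \<in> Ob C"
  shows "a \<in> carrier (R U) \<Longrightarrow> b \<in> carrier (R U) \<Longrightarrow> \<phi> [a, b] \<in> carrier (R V)"
    "a \<in> carrier (R U) \<Longrightarrow> b \<in> carrier (R U) \<Longrightarrow> c \<in> carrier (R U) \<Longrightarrow>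
      \<phi> [a \<oplus>\<^bsub>R U\<^esub> b, c] = \<phi> [a, c] \<oplus>\<^bsub>R V\<^esub> \<phi> [b, c]"
    "a \<in> carrier (R U) \<Longrightarrow> b \<in> carrier (R U) \<Longrightarrow> c \<in> carrier (R U) \<Longrightarrow>
      \<phi> [c, a \<oplus>\<^bsub>R U\<^esub> b] = \<phi> [c, a] \<oplus>\<^bsub>R V\<^esub> \<phi> [c, b]"
    "a \<in> carrier (R U) \<Longrightarrow> b \<in> carrier (R U) \<Longrightarrow> \<phi> [psmult A U r a, b] = psmult A V r (\<phi> [a, b])"
    "a \<in> carrier (R U) \<Longrightarrow> b \<in> carrier (R U) \<Longrightarrow> \<phi> [b, psmult A U r a] = psmult A V r (\<phi> [b, a])"
    "a \<in> carrier (R U) \<Longrightarrow> b \<in> carrier (R U) \<Longrightarrow> \<phi> [\<ominus>\<^bsub>R U\<^esub> a, b] = \<ominus>\<^bsub>R V\<^esub> \<phi> [a, b]"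
    "a \<in> carrier (R U) \<Longrightarrow> b \<in> carrier (R U) \<Longrightarrow> \<phi> [b, \<ominus>\<^bsub>R U\<^esub> a] = \<ominus>\<^bsub>R V\<^esub> \<phi> [b, a]"
    "b \<in> carrier (R U) \<Longrightarrow> \<phi> [\<zero>\<^bsub>R U\<^esub>, b] = \<zero>\<^bsub>R V\<^esub>"
    "b \<in> carrier (R U) \<Longrightarrow> \<phi> [b, \<zero>\<^bsub>R U\<^esub>] = \<zero>\<^bsub>R V\<^esub>"
proof -
  note h = assms(1)[unfolded mlin2]
  show c: "a \<in> carrier (R U) \<Longrightarrow> b \<in> carrier (R U) \<Longrightarrow> \<phi> [a, b] \<in> carrier (R V)" for a b
    using h by blast
  show "a \<in> carrier (R U) \<Longrightarrow> b \<in> carrier (R U) \<Longrightarrow> c \<in> carrier (R U) \<Longrightarrow>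
      \<phi> [a \<oplus>\<^bsub>R U\<^esub> b, c] = \<phi> [a, c] \<oplus>\<^bsub>R V\<^esub> \<phi> [b, c]"
    using h by blast
  show "a \<in> carrier (R U) \<Longrightarrow> b \<in> carrier (R U) \<Longrightarrow> c \<in> carrier (R U) \<Longrightarrow>
      \<phi> [c, a \<oplus>\<^bsub>R U\<^esub> b] = \<phi> [c, a] \<oplus>\<^bsub>R V\<^esub> \<phi> [c, b]"
    using h by blast
  show s1: "a \<in> carrier (R U) \<Longrightarrow> b \<in> carrier (R U) \<Longrightarrow>
      \<phi> [psmult A U r a, b] = psmult A V r (\<phi> [a, b])" for a b r
    using h by blast
  show s2: "a \<in> carrier (R U) \<Longrightarrow> b \<in> carrier (R U) \<Longrightarrow>
      \<phi> [b, psmult A U r a] = psmult A V r (\<phi> [b, a])" for a b r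
    using h by blast
  show "a \<in> carrier (R U) \<Longrightarrow> b \<in> carrier (R U) \<Longrightarrow> \<phi> [\<ominus>\<^bsub>R U\<^esub> a, b] = \<ominus>\<^bsub>R V\<^esub> \<phi> [a, b]"
    using s1[of a b "-1"] c[of a b] assms(2,3) by simp
  show "a \<in> carrier (R U) \<Longrightarrow> b \<in> carrier (R U) \<Longrightarrow> \<phi> [b, \<ominus>\<^bsub>R U\<^esub> a] = \<ominus>\<^bsub>R V\<^esub> \<phi> [b, a]"
    using s2[of a b "-1"] c[of b a] assms(2,3) by simp
  show "b \<in> carrier (R U) \<Longrightarrow> \<phi> [\<zero>\<^bsub>R U\<^esub>, b] = \<zero>\<^bsub>R V\<^esub>"
    using s1[of "\<zero>\<^bsub>R U\<^esub>" b 0] c[of "\<zero>\<^bsub>R U\<^esub>" b] assms(2,3) by simp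
  show "b \<in> carrier (R U) \<Longrightarrow> \<phi> [b, \<zero>\<^bsub>R U\<^esub>] = \<zero>\<^bsub>R V\<^esub>"
    using s2[of "\<zero>\<^bsub>R U\<^esub>" b 0] c[of b "\<zero>\<^bsub>R U\<^esub>"] assms(2,3) by simp
qed

end

section \<open>First order deformations and 2-cocycles\<close>

locale first_order_data = gs_presheaf C A
  for C :: "('o,'m) cat" and A :: "('o,'m,'a,'k::comm_ring_1) tpsh" +
  fixes m1 f1 c1 :: "('o,'m,'a) cochn"
  assumes m1_cochain: "cochain_pq C A 0 2 m1"
    and f1_cochain: "cochain_pq C A 1 1 f1"
    and c1_cochain: "cochain_pq C A 2 0 c1"
begin

lemma m1_mlin: "U \<in> Ob C \<Longrightarrow> mlin A U U 2 (m1 (U, []))"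
  using m1_cochain cochain_pq0_iff by blast

lemma f1_mlin: "u \<in> Mor C \<Longrightarrow> mlin A (Cod C u) (Dom C u) 1 (f1 (Dom C u, [u]))"
  using f1_cochain cochain_pq1_iff by blast

lemma m1_closed[simp]:
  "U \<in> Ob C \<Longrightarrow> a \<in> carrier (R U) \<Longrightarrow> b \<in> carrier (R U) \<Longrightarrow> m1 (U, []) [a, b] \<in> carrier (R U)"
  using mlin2D(1)[OF m1_mlin] by simp

lemma m1_linear[simp]:
  assumes U: "U \<in> Ob C"
  shows "a \<in> carrier (R U) \<Longrightarrow> b \<in> carrier (R U) \<Longrightarrow> c \<in> carrier (R U) \<Longrightarrow>
      m1 (U, []) [a \<oplus>\<^bsub>R U\<^esub> b, c] = m1 (U, []) [a, c] \<oplus>\<^bsub>R U\<^esub> m1 (U, []) [b, c]"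
    and "a \<in> carrier (R U) \<Longrightarrow> b \<in> carrier (R U) \<Longrightarrow> c \<in> carrier (R U) \<Longrightarrow>
      m1 (U, []) [c, a \<oplus>\<^bsub>R U\<^esub> b] = m1 (U, []) [c, a] \<oplus>\<^bsub>R U\<^esub> m1 (U, []) [c, b]"
    and "a \<in> carrier (R U) \<Longrightarrow> b \<in> carrier (R U) \<Longrightarrow>
      m1 (U, []) [psmult A U r a, b] = psmult A U r (m1 (U, []) [a, b])"
    and "a \<in> carrier (R U) \<Longrightarrow> b \<in> carrier (R U) \<Longrightarrow>
      m1 (U, []) [b, psmult A U r a] = psmult A U r (m1 (U, []) [b, a])"
    and "a \<in> carrier (R U) \<Longrightarrow> b \<in> carrier (R U) \<Longrightarrow>
      m1 (U, []) [\<ominus>\<^bsub>R U\<^esub> a, b] = \<ominus>\<^bsub>R U\<^esub> m1 (U, []) [a, b]"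
    and "a \<in> carrier (R U) \<Longrightarrow> b \<in> carrier (R U) \<Longrightarrow>
      m1 (U, []) [b, \<ominus>\<^bsub>R U\<^esub> a] = \<ominus>\<^bsub>R U\<^esub> m1 (U, []) [b, a]"
    and "b \<in> carrier (R U) \<Longrightarrow> m1 (U, []) [\<zero>\<^bsub>R U\<^esub>, b] = \<zero>\<^bsub>R U\<^esub>"
    and "b \<in> carrier (R U) \<Longrightarrow> m1 (U, []) [b, \<zero>\<^bsub>R U\<^esub>] = \<zero>\<^bsub>R U\<^esub>"
  by (simp_all add: mlin2D[OF m1_mlin[OF U] U U])

lemma f1_closed[simp]:
  "u \<in> Mor C \<Longrightarrow> V = Dom C u \<Longrightarrow> a \<in> carrier (R (Cod C u)) \<Longrightarrow> f1 (V, [u]) [a] \<in> carrier (R V)"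
  using mlin1D(1)[OF f1_mlin] by simp

lemma f1_linear[simp]:
  assumes u: "u \<in> Mor C" and V: "V = Dom C u"
  shows "a \<in> carrier (R (Cod C u)) \<Longrightarrow> b \<in> carrier (R (Cod C u)) \<Longrightarrow>
      f1 (V, [u]) [a \<oplus>\<^bsub>R (Cod C u)\<^esub> b] = f1 (V, [u]) [a] \<oplus>\<^bsub>R V\<^esub> f1 (V, [u]) [b]"
    and "a \<in> carrier (R (Cod C u)) \<Longrightarrow> f1 (V, [u]) [psmult A (Cod C u) r a] = psmult A V r (f1 (V, [u]) [a])"
    and "a \<in> carrier (R (Cod C u)) \<Longrightarrow> f1 (V, [u]) [\<ominus>\<^bsub>R (Cod C u)\<^esub> a] = \<ominus>\<^bsub>R V\<^esub> f1 (V, [u]) [a]"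
    and "f1 (V, [u]) [\<zero>\<^bsub>R (Cod C u)\<^esub>] = \<zero>\<^bsub>R V\<^esub>"
  unfolding V by (simp_all add: mlin1D[OF f1_mlin[OF u] cod_ob[OF u] dom_ob[OF u]])

lemma c1_closed[simp]:
  "u \<in> Mor C \<Longrightarrow> v \<in> Mor C \<Longrightarrow> Cod C v = Dom C u \<Longrightarrow> W = Dom C v \<Longrightarrow> c1 (W, [v, u]) [] \<in> carrier (R W)"
  using c1_cochain unfolding cochain_pq2_iff mlin0 by blast

definition m1_normalized :: bool where
  "m1_normalized \<longleftrightarrow> (\<forall>U\<in>Ob C. \<forall>a\<in>carrier (R U).
     m1 (U, []) [\<one>\<^bsub>R U\<^esub>, a] = \<zero>\<^bsub>R U\<^esub> \<and> m1 (U, []) [a, \<one>\<^bsub>R U\<^esub>] = \<zero>\<^bsub>R U\<^esub>)"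

definition f1_normalized :: bool where
  "f1_normalized \<longleftrightarrow> (\<forall>u\<in>Mor C. f1 (Dom C u, [u]) [\<one>\<^bsub>R (Cod C u)\<^esub>] = \<zero>\<^bsub>R (Dom C u)\<^esub>)"

definition f1_reduced :: bool where
  "f1_reduced \<longleftrightarrow> (\<forall>u\<in>Mor C. u = Ident C (Dom C u) \<longrightarrow>
     (\<forall>a\<in>carrier (R (Cod C u)). f1 (Dom C u, [u]) [a] = \<zero>\<^bsub>R (Dom C u)\<^esub>))"

definition c1_reduced :: bool where
  "c1_reduced \<longleftrightarrow> (\<forall>u\<in>Mor C. \<forall>v\<in>Mor C. Cod C v = Dom C u \<longrightarrow>
     (v = Ident C (Dom C v) \<or> u = Ident C (Dom C u)) \<longrightarrow> c1 (Dom C v, [v, u]) [] = \<zero>\<^bsub>R (Dom C v)\<^esub>)"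

text \<open>The components of \<open>d\<^sub>G\<^sub>S (m1, f1, c1)\<close> in bidegrees (0,3), (1,2), (2,1) and (3,0),
  with the subtracted terms moved to the right-hand side.\<close>

definition cocycle_eq_03 :: "'o \<Rightarrow> 'a \<Rightarrow> 'a \<Rightarrow> 'a \<Rightarrow> bool" where
  "cocycle_eq_03 U a b c \<longleftrightarrow>
     a \<otimes>\<^bsub>R U\<^esub> m1 (U, []) [b, c] \<oplus>\<^bsub>R U\<^esub> m1 (U, []) [a, b \<otimes>\<^bsub>R U\<^esub> c] =
     m1 (U, []) [a \<otimes>\<^bsub>R U\<^esub> b, c] \<oplus>\<^bsub>R U\<^esub> m1 (U, []) [a, b] \<otimes>\<^bsub>R U\<^esub> c"

definition cocycle_eq_12 :: "'m \<Rightarrow> 'a \<Rightarrow> 'a \<Rightarrow> bool" where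
  "cocycle_eq_12 u a b \<longleftrightarrow>
     pres A u a \<otimes>\<^bsub>R (Dom C u)\<^esub> f1 (Dom C u, [u]) [b]
       \<oplus>\<^bsub>R (Dom C u)\<^esub> f1 (Dom C u, [u]) [a] \<otimes>\<^bsub>R (Dom C u)\<^esub> pres A u b
       \<oplus>\<^bsub>R (Dom C u)\<^esub> m1 (Dom C u, []) [pres A u a, pres A u b] =
     f1 (Dom C u, [u]) [a \<otimes>\<^bsub>R (Cod C u)\<^esub> b] \<oplus>\<^bsub>R (Dom C u)\<^esub> pres A u (m1 (Cod C u, []) [a, b])"

definition cocycle_eq_21 :: "'m \<Rightarrow> 'm \<Rightarrow> 'a \<Rightarrow> bool" where
  "cocycle_eq_21 u v a \<longleftrightarrow>
     pres A v (pres A u a) \<otimes>\<^bsub>R (Dom C v)\<^esub> c1 (Dom C v, [v, u]) []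
       \<oplus>\<^bsub>R (Dom C v)\<^esub> f1 (Dom C v, [Comp C u v]) [a] =
     c1 (Dom C v, [v, u]) [] \<otimes>\<^bsub>R (Dom C v)\<^esub> pres A v (pres A u a)
       \<oplus>\<^bsub>R (Dom C v)\<^esub> pres A v (f1 (Dom C u, [u]) [a]) \<oplus>\<^bsub>R (Dom C v)\<^esub> f1 (Dom C v, [v]) [pres A u a]"

definition cocycle_eq_30 :: "'m \<Rightarrow> 'm \<Rightarrow> 'm \<Rightarrow> bool" where
  "cocycle_eq_30 u v w \<longleftrightarrow>
     pres A w (c1 (Dom C v, [v, u]) []) \<oplus>\<^bsub>R (Dom C w)\<^esub> c1 (Dom C w, [w, Comp C u v]) [] =
     c1 (Dom C w, [Comp C v w, u]) [] \<oplus>\<^bsub>R (Dom C w)\<^esub> c1 (Dom C w, [w, v]) []"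

definition cocycle_03 :: bool where
  "cocycle_03 \<longleftrightarrow>
     (\<forall>U\<in>Ob C. \<forall>a\<in>carrier (R U). \<forall>b\<in>carrier (R U). \<forall>c\<in>carrier (R U). cocycle_eq_03 U a b c)"

definition cocycle_12 :: bool where
  "cocycle_12 \<longleftrightarrow> (\<forall>u\<in>Mor C. \<forall>a\<in>carrier (R (Cod C u)). \<forall>b\<in>carrier (R (Cod C u)). cocycle_eq_12 u a b)"

definition cocycle_21 :: bool where
  "cocycle_21 \<longleftrightarrow>
     (\<forall>u\<in>Mor C. \<forall>v\<in>Mor C. Cod C v = Dom C u \<longrightarrow> (\<forall>a\<in>carrier (R (Cod C u)). cocycle_eq_21 u v a))"

definition cocycle_30 :: bool where
  "cocycle_30 \<longleftrightarrow>
     (\<forall>u\<in>Mor C. \<forall>v\<in>Mor C. \<forall>w\<in>Mor C. Cod C v = Dom C u \<longrightarrow> Cod C w = Dom C v \<longrightarrow> cocycle_eq_30 u v w)"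

lemma dGS2_03_eq_zero_iff:
  assumes U: "U \<in> Ob C" and abc: "a \<in> carrier (R U)" "b \<in> carrier (R U)" "c \<in> carrier (R U)"
  shows "(dGS C A 2 (pack3 m1 f1 c1) 0 (U, []) [a, b, c] = \<zero>\<^bsub>R U\<^esub>) \<longleftrightarrow> cocycle_eq_03 U a b c"
proof -
  interpret r: ring "R U" using ring_R[OF U] .
  have "dGS C A 2 (pack3 m1 f1 c1) 0 (U, []) [a, b, c] =
     (a \<otimes>\<^bsub>R U\<^esub> m1 (U, []) [b, c] \<oplus>\<^bsub>R U\<^esub> m1 (U, []) [a, b \<otimes>\<^bsub>R U\<^esub> c]) \<oplus>\<^bsub>R U\<^esub>
     \<ominus>\<^bsub>R U\<^esub> (m1 (U, []) [a \<otimes>\<^bsub>R U\<^esub> b, c] \<oplus>\<^bsub>R U\<^esub> m1 (U, []) [a, b] \<otimes>\<^bsub>R U\<^esub> c)"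
    using abc U
    by (simp add: dGS_expand pack3_def) (simp add: r.ring_simprules)
  then show ?thesis unfolding cocycle_eq_03_def using abc U by (simp add: r.add_neg_eq_zero_iff)
qed

lemma dGS2_12_eq_zero_iff:
  assumes u: "u \<in> Mor C" and ab: "a \<in> carrier (R (Cod C u))" "b \<in> carrier (R (Cod C u))"
  shows "(dGS C A 2 (pack3 m1 f1 c1) 1 (Dom C u, [u]) [a, b] = \<zero>\<^bsub>R (Dom C u)\<^esub>) \<longleftrightarrow> cocycle_eq_12 u a b"
proof -
  interpret r: ring "R (Dom C u)" using ring_R u by simp
  interpret r2: ring "R (Cod C u)" using ring_R u by simp
  have "dGS C A 2 (pack3 m1 f1 c1) 1 (Dom C u, [u]) [a, b] =
     (pres A u a \<otimes>\<^bsub>R (Dom C u)\<^esub> f1 (Dom C u, [u]) [b]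
       \<oplus>\<^bsub>R (Dom C u)\<^esub> f1 (Dom C u, [u]) [a] \<otimes>\<^bsub>R (Dom C u)\<^esub> pres A u b
      \<oplus>\<^bsub>R (Dom C u)\<^esub> m1 (Dom C u, []) [pres A u a, pres A u b]) \<oplus>\<^bsub>R (Dom C u)\<^esub>
     \<ominus>\<^bsub>R (Dom C u)\<^esub> (f1 (Dom C u, [u]) [a \<otimes>\<^bsub>R (Cod C u)\<^esub> b]
       \<oplus>\<^bsub>R (Dom C u)\<^esub> pres A u (m1 (Cod C u, []) [a, b]))"
    using ab u
    by (simp add: dGS_expand pack3_def) (simp add: r.ring_simprules)
  then show ?thesis unfolding cocycle_eq_12_def using ab u by (simp add: r.add_neg_eq_zero_iff)
qed

lemma dGS2_21_eq_zero_iff: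
  assumes uv: "u \<in> Mor C" "v \<in> Mor C" "Cod C v = Dom C u" and a: "a \<in> carrier (R (Cod C u))"
  shows "(dGS C A 2 (pack3 m1 f1 c1) 2 (Dom C v, [v, u]) [a] = \<zero>\<^bsub>R (Dom C v)\<^esub>) \<longleftrightarrow> cocycle_eq_21 u v a"
proof -
  interpret r: ring "R (Dom C v)" using ring_R uv by simp
  have "dGS C A 2 (pack3 m1 f1 c1) 2 (Dom C v, [v, u]) [a] =
     (pres A v (pres A u a) \<otimes>\<^bsub>R (Dom C v)\<^esub> c1 (Dom C v, [v, u]) []
       \<oplus>\<^bsub>R (Dom C v)\<^esub> f1 (Dom C v, [Comp C u v]) [a]) \<oplus>\<^bsub>R (Dom C v)\<^esub>
     \<ominus>\<^bsub>R (Dom C v)\<^esub> (c1 (Dom C v, [v, u]) [] \<otimes>\<^bsub>R (Dom C v)\<^esub> pres A v (pres A u a)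
       \<oplus>\<^bsub>R (Dom C v)\<^esub> pres A v (f1 (Dom C u, [u]) [a])
      \<oplus>\<^bsub>R (Dom C v)\<^esub> f1 (Dom C v, [v]) [pres A u a])"
    using a uv
    by (simp add: dGS_expand pack3_def pres_comp) (simp add: r.ring_simprules)
  then show ?thesis unfolding cocycle_eq_21_def using a uv by (simp add: r.add_neg_eq_zero_iff)
qed

lemma dGS2_30_eq_zero_iff:
  assumes uvw: "u \<in> Mor C" "v \<in> Mor C" "w \<in> Mor C" "Cod C v = Dom C u" "Cod C w = Dom C v"
  shows "(dGS C A 2 (pack3 m1 f1 c1) 3 (Dom C w, [w, v, u]) [] = \<zero>\<^bsub>R (Dom C w)\<^esub>) \<longleftrightarrow> cocycle_eq_30 u v w"
proof -
  interpret r: ring "R (Dom C w)" using ring_R uvw by simp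
  have "dGS C A 2 (pack3 m1 f1 c1) 3 (Dom C w, [w, v, u]) [] =
     (c1 (Dom C w, [Comp C v w, u]) [] \<oplus>\<^bsub>R (Dom C w)\<^esub> c1 (Dom C w, [w, v]) []) \<oplus>\<^bsub>R (Dom C w)\<^esub>
     \<ominus>\<^bsub>R (Dom C w)\<^esub> (pres A w (c1 (Dom C v, [v, u]) []) \<oplus>\<^bsub>R (Dom C w)\<^esub> c1 (Dom C w, [w, Comp C u v]) [])"
    using uvw
    by (simp add: dGS_expand pack3_def) (simp add: r.ring_simprules)
  then show ?thesis unfolding cocycle_eq_30_def using uvw by (auto simp: r.add_neg_eq_zero_iff)
qed

lemma NR2_iff: "NR C A 2 (pack3 m1 f1 c1) \<longleftrightarrow> m1_normalized \<and> f1_normalized \<and> f1_reduced \<and> c1_reduced"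
proof -
  have cochain: "cochain C A 2 (pack3 m1 f1 c1)"
    unfolding cochain_def all_le_2 pack3_def using m1_cochain f1_cochain c1_cochain by simp
  have normalized: "normalized C A 2 (pack3 m1 f1 c1) \<longleftrightarrow> m1_normalized \<and> f1_normalized"
    unfolding normalized_def all_le_2 pack3_def m1_normalized_def f1_normalized_def
    by (auto simp del: One_nat_def simp: ball_nerve0 ball_nerve1 ball_nerve_Suc_0 ball_nerve2 ball_args0
        ball_args1 ball_args_Suc_0 ball_args2 ex_less_Suc_0 ex_less_2 ring_of_simps)
      (use R_one_closed in blast)+
  have reduced: "reduced C A 2 (pack3 m1 f1 c1) \<longleftrightarrow> f1_reduced \<and> c1_reduced"
    unfolding reduced_def all_le_2 pack3_def f1_reduced_def c1_reduced_def
    by (auto simp del: One_nat_def simp: ball_nerve0 ball_nerve1 ball_nerve_Suc_0 ball_nerve2 ball_args0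
        ball_args1 ball_args_Suc_0 ball_args2 degenerate_def nerve0_iff ring_of_simps)
  show ?thesis unfolding NR_def using cochain normalized reduced by blast
qed

lemma dGS2_eq_zero_iff:
  "ceq C A 3 (dGS C A 2 (pack3 m1 f1 c1)) (czero A) \<longleftrightarrow> cocycle_03 \<and> cocycle_12 \<and> cocycle_21 \<and> cocycle_30"
  unfolding ceq_def all_le_3 czero_def czero1_def cocycle_03_def cocycle_12_def cocycle_21_def cocycle_30_def
  by (simp del: One_nat_def add: ball_nerve0 ball_nerve1 ball_nerve_Suc_0 ball_nerve2 ball_nerve3
      ball_args0 ball_args1 ball_args_Suc_0 ball_args2 ball_args3 ring_of_simps
      dGS2_03_eq_zero_iff dGS2_12_eq_zero_iff dGS2_21_eq_zero_iff dGS2_30_eq_zero_iff)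

abbreviation Aeps :: "('o,'m,'a \<times> 'a,'k dual) tpsh" where "Aeps \<equiv> deform C A m1 f1 c1"

lemma Aeps_simps[simp]:
  "pcar Aeps U = carrier (R U) \<times> carrier (R U)"
  "padd Aeps U (a, b) (a', b') = (a \<oplus>\<^bsub>R U\<^esub> a', b \<oplus>\<^bsub>R U\<^esub> b')"
  "pzero Aeps U = (\<zero>\<^bsub>R U\<^esub>, \<zero>\<^bsub>R U\<^esub>)"
  "psmult Aeps U r (a, b) = (psmult A U (re r) a, psmult A U (re r) b \<oplus>\<^bsub>R U\<^esub> psmult A U (eps r) a)"
  "pmul Aeps U (a, b) (a', b') = (a \<otimes>\<^bsub>R U\<^esub> a',
      (a \<otimes>\<^bsub>R U\<^esub> b' \<oplus>\<^bsub>R U\<^esub> b \<otimes>\<^bsub>R U\<^esub> a') \<oplus>\<^bsub>R U\<^esub> m1 (U, []) [a, a'])"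
  "pone Aeps U = (\<one>\<^bsub>R U\<^esub>, \<zero>\<^bsub>R U\<^esub>)"
  "pres Aeps u (a, b) = (pres A u a, pres A u b \<oplus>\<^bsub>R (Dom C u)\<^esub> f1 (Dom C u, [u]) [a])"
  "ptw Aeps u v = (\<one>\<^bsub>R (Dom C v)\<^esub>, c1 (Dom C v, [v, u]) [])"
  by (simp_all add: deform_def ring_of_simps)

lemma Aeps_is_algebra_iff:
  assumes U: "U \<in> Ob C"
  shows "is_algebra Aeps U \<longleftrightarrow>
    (\<forall>a\<in>carrier (R U). m1 (U, []) [\<one>\<^bsub>R U\<^esub>, a] = \<zero>\<^bsub>R U\<^esub> \<and> m1 (U, []) [a, \<one>\<^bsub>R U\<^esub>] = \<zero>\<^bsub>R U\<^esub>) \<and>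
    (\<forall>a\<in>carrier (R U). \<forall>b\<in>carrier (R U). \<forall>c\<in>carrier (R U). cocycle_eq_03 U a b c)"
proof -
  interpret r: ring "R U" using ring_R[OF U] .
  note sms = smult_laws[OF U]
  show ?thesis
  proof
    assume h: "is_algebra Aeps U"
    have un: "m1 (U, []) [\<one>\<^bsub>R U\<^esub>, a] = \<zero>\<^bsub>R U\<^esub> \<and> m1 (U, []) [a, \<one>\<^bsub>R U\<^esub>] = \<zero>\<^bsub>R U\<^esub>"
      if a: "a \<in> carrier (R U)" for a
    proof -
      have "pmul Aeps U (pone Aeps U) (a, \<zero>\<^bsub>R U\<^esub>) = (a, \<zero>\<^bsub>R U\<^esub>) \<and> pmul Aeps U (a, \<zero>\<^bsub>R U\<^esub>) (pone Aeps U) = (a, \<zero>\<^bsub>R U\<^esub>)"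
        by (rule is_algebra_mult_one[OF h]) (simp add: a U)
      then show ?thesis using a U by (simp add: r.ring_simprules)
    qed
    have as: "cocycle_eq_03 U a b c" if abc: "a \<in> carrier (R U)" "b \<in> carrier (R U)" "c \<in> carrier (R U)" for a b c
    proof -
      have "pmul Aeps U (pmul Aeps U (a, \<zero>\<^bsub>R U\<^esub>) (b, \<zero>\<^bsub>R U\<^esub>)) (c, \<zero>\<^bsub>R U\<^esub>) =
            pmul Aeps U (a, \<zero>\<^bsub>R U\<^esub>) (pmul Aeps U (b, \<zero>\<^bsub>R U\<^esub>) (c, \<zero>\<^bsub>R U\<^esub>))"
        by (rule is_algebra_mult_assoc[OF h]) (simp_all add: abc U)
      then show ?thesis using abc U unfolding cocycle_eq_03_def by (simp add: r.ring_simprules)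
    qed
    show "(\<forall>a\<in>carrier (R U). m1 (U, []) [\<one>\<^bsub>R U\<^esub>, a] = \<zero>\<^bsub>R U\<^esub> \<and> m1 (U, []) [a, \<one>\<^bsub>R U\<^esub>] = \<zero>\<^bsub>R U\<^esub>) \<and>
    (\<forall>a\<in>carrier (R U). \<forall>b\<in>carrier (R U). \<forall>c\<in>carrier (R U). cocycle_eq_03 U a b c)" using un as by blast
  next
    assume h: "(\<forall>a\<in>carrier (R U). m1 (U, []) [\<one>\<^bsub>R U\<^esub>, a] = \<zero>\<^bsub>R U\<^esub> \<and> m1 (U, []) [a, \<one>\<^bsub>R U\<^esub>] = \<zero>\<^bsub>R U\<^esub>) \<and>
    (\<forall>a\<in>carrier (R U). \<forall>b\<in>carrier (R U). \<forall>c\<in>carrier (R U). cocycle_eq_03 U a b c)"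
    have as: "m1 (U, []) [a, b \<otimes>\<^bsub>R U\<^esub> c] = m1 (U, []) [a \<otimes>\<^bsub>R U\<^esub> b, c]
      \<oplus>\<^bsub>R U\<^esub> m1 (U, []) [a, b] \<otimes>\<^bsub>R U\<^esub> c
        \<oplus>\<^bsub>R U\<^esub> \<ominus>\<^bsub>R U\<^esub> (a \<otimes>\<^bsub>R U\<^esub> m1 (U, []) [b, c])"
      if abc: "a \<in> carrier (R U)" "b \<in> carrier (R U)" "c \<in> carrier (R U)" for a b c
    proof -
      have "cocycle_eq_03 U a b c" using h abc by blast
      then have "a \<otimes>\<^bsub>R U\<^esub> m1 (U, []) [b, c] \<oplus>\<^bsub>R U\<^esub> m1 (U, []) [a, b \<otimes>\<^bsub>R U\<^esub> c] =
     m1 (U, []) [a \<otimes>\<^bsub>R U\<^esub> b, c] \<oplus>\<^bsub>R U\<^esub> m1 (U, []) [a, b] \<otimes>\<^bsub>R U\<^esub> c" unfolding cocycle_eq_03_def .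
      from r.eq_diff_if_add_eq[OF this] show ?thesis using abc U by simp
    qed
    have u1: "m1 (U, []) [\<one>\<^bsub>R U\<^esub>, a] = \<zero>\<^bsub>R U\<^esub>" "m1 (U, []) [a, \<one>\<^bsub>R U\<^esub>] = \<zero>\<^bsub>R U\<^esub>"
      if "a \<in> carrier (R U)" for a using h that by blast+
    show "is_algebra Aeps U"
      unfolding is_algebra_def Let_def
      apply (intro conjI)
      using U apply (simp_all add: r.ring_simprules sms u1 as)
      done
  qed
qed

lemma Aeps_restriction_mult:
  assumes u: "u \<in> Mor C"
    and cocycle: "\<forall>a\<in>carrier (R (Cod C u)). \<forall>b\<in>carrier (R (Cod C u)). cocycle_eq_12 u a b"
    and xy: "x \<in> pcar Aeps (Cod C u)" "y \<in> pcar Aeps (Cod C u)"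
  shows "pres Aeps u (pmul Aeps (Cod C u) x y) = pmul Aeps (Dom C u) (pres Aeps u x) (pres Aeps u y)"
proof -
  interpret r: ring "R (Dom C u)" using ring_R u by simp
  interpret r2: ring "R (Cod C u)" using ring_R u by simp
  obtain a b a' b' where x: "x = (a, b)" and y: "y = (a', b')" by (cases x, cases y)
  have c: "a \<in> carrier (R (Cod C u))" "b \<in> carrier (R (Cod C u))"
    "a' \<in> carrier (R (Cod C u))" "b' \<in> carrier (R (Cod C u))"
    using xy x y by auto
  have E: "f1 (Dom C u, [u]) [a \<otimes>\<^bsub>R (Cod C u)\<^esub> a'] \<oplus>\<^bsub>R (Dom C u)\<^esub> pres A u (m1 (Cod C u, []) [a, a']) =
    pres A u a \<otimes>\<^bsub>R (Dom C u)\<^esub> f1 (Dom C u, [u]) [a']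
      \<oplus>\<^bsub>R (Dom C u)\<^esub> f1 (Dom C u, [u]) [a] \<otimes>\<^bsub>R (Dom C u)\<^esub> pres A u a'
  \<oplus>\<^bsub>R (Dom C u)\<^esub> m1 (Dom C u, []) [pres A u a, pres A u a']"
    using cocycle c unfolding cocycle_eq_12_def by auto
  have s1: "pres A u ((a \<otimes>\<^bsub>R (Cod C u)\<^esub> b'
    \<oplus>\<^bsub>R (Cod C u)\<^esub> b \<otimes>\<^bsub>R (Cod C u)\<^esub> a') \<oplus>\<^bsub>R (Cod C u)\<^esub> m1 (Cod C u, []) [a, a'])
      \<oplus>\<^bsub>R (Dom C u)\<^esub> f1 (Dom C u, [u]) [a \<otimes>\<^bsub>R (Cod C u)\<^esub> a'] =
    (pres A u a \<otimes>\<^bsub>R (Dom C u)\<^esub> pres A u b'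
      \<oplus>\<^bsub>R (Dom C u)\<^esub> pres A u b \<otimes>\<^bsub>R (Dom C u)\<^esub> pres A u a') \<oplus>\<^bsub>R (Dom C u)\<^esub>
    (f1 (Dom C u, [u]) [a \<otimes>\<^bsub>R (Cod C u)\<^esub> a'] \<oplus>\<^bsub>R (Dom C u)\<^esub> pres A u (m1 (Cod C u, []) [a, a']))"
    using c u by (simp add: r.ring_simprules r2.ring_simprules)
  have s2: "pres A u a \<otimes>\<^bsub>R (Dom C u)\<^esub> (pres A u b'
    \<oplus>\<^bsub>R (Dom C u)\<^esub> f1 (Dom C u, [u]) [a']) \<oplus>\<^bsub>R (Dom C u)\<^esub>
      (pres A u b \<oplus>\<^bsub>R (Dom C u)\<^esub> f1 (Dom C u, [u]) [a]) \<otimes>\<^bsub>R (Dom C u)\<^esub> pres A u a' \<oplus>\<^bsub>R (Dom C u)\<^esub>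
      m1 (Dom C u, []) [pres A u a, pres A u a'] =
    (pres A u a \<otimes>\<^bsub>R (Dom C u)\<^esub> pres A u b'
      \<oplus>\<^bsub>R (Dom C u)\<^esub> pres A u b \<otimes>\<^bsub>R (Dom C u)\<^esub> pres A u a') \<oplus>\<^bsub>R (Dom C u)\<^esub>
    (pres A u a \<otimes>\<^bsub>R (Dom C u)\<^esub> f1 (Dom C u, [u]) [a']
      \<oplus>\<^bsub>R (Dom C u)\<^esub> f1 (Dom C u, [u]) [a] \<otimes>\<^bsub>R (Dom C u)\<^esub> pres A u a'
  \<oplus>\<^bsub>R (Dom C u)\<^esub> m1 (Dom C u, []) [pres A u a, pres A u a'])"
    using c u by (simp add: r.ring_simprules r2.ring_simprules)
  show ?thesis
    unfolding x y Aeps_simps s1 s2 E using c u by simp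
qed

lemma Aeps_restriction_alg_map_iff:
  assumes u: "u \<in> Mor C"
  shows "alg_map Aeps (Cod C u) Aeps (Dom C u) (pres Aeps u) \<longleftrightarrow>
    f1 (Dom C u, [u]) [\<one>\<^bsub>R (Cod C u)\<^esub>] = \<zero>\<^bsub>R (Dom C u)\<^esub> \<and>
    (\<forall>a\<in>carrier (R (Cod C u)). \<forall>b\<in>carrier (R (Cod C u)). cocycle_eq_12 u a b)"
proof -
  interpret r: ring "R (Dom C u)" using ring_R u by simp
  interpret r2: ring "R (Cod C u)" using ring_R u by simp
  have U: "Cod C u \<in> Ob C" "Dom C u \<in> Ob C" using u by simp_all
  show ?thesis
  proof
    assume h: "alg_map Aeps (Cod C u) Aeps (Dom C u) (pres Aeps u)"
    have "cocycle_eq_12 u a b" if ab: "a \<in> carrier (R (Cod C u))" "b \<in> carrier (R (Cod C u))" for a b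
    proof -
      have "pres Aeps u (pmul Aeps (Cod C u) (a, \<zero>\<^bsub>R (Cod C u)\<^esub>) (b, \<zero>\<^bsub>R (Cod C u)\<^esub>)) =
            pmul Aeps (Dom C u) (pres Aeps u (a, \<zero>\<^bsub>R (Cod C u)\<^esub>)) (pres Aeps u (b, \<zero>\<^bsub>R (Cod C u)\<^esub>))"
        by (rule alg_map_multD[OF h]) (simp_all add: ab u)
      then show ?thesis using ab u unfolding cocycle_eq_12_def by (simp add: r.ring_simprules r2.ring_simprules)
    qed
    then show "f1 (Dom C u, [u]) [\<one>\<^bsub>R (Cod C u)\<^esub>] = \<zero>\<^bsub>R (Dom C u)\<^esub> \<and>
      (\<forall>a\<in>carrier (R (Cod C u)). \<forall>b\<in>carrier (R (Cod C u)). cocycle_eq_12 u a b)"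
      using alg_map_oneD[OF h] u by (simp add: r.ring_simprules)
  next
    assume h: "f1 (Dom C u, [u]) [\<one>\<^bsub>R (Cod C u)\<^esub>] = \<zero>\<^bsub>R (Dom C u)\<^esub> \<and>
      (\<forall>a\<in>carrier (R (Cod C u)). \<forall>b\<in>carrier (R (Cod C u)). cocycle_eq_12 u a b)"
    show "alg_map Aeps (Cod C u) Aeps (Dom C u) (pres Aeps u)"
    proof (rule alg_mapI)
      show "pres Aeps u (pmul Aeps (Cod C u) x y) = pmul Aeps (Dom C u) (pres Aeps u x) (pres Aeps u y)"
        if "x \<in> pcar Aeps (Cod C u)" "y \<in> pcar Aeps (Cod C u)" for x y
        using Aeps_restriction_mult[OF u _ that] h by blast
    qed (use h u in \<open>auto simp: r.ring_simprules smult_laws[OF U(1)] smult_laws[OF U(2)]\<close>)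
  qed
qed

lemma Aeps_restriction_ident_iff:
  "(\<forall>U\<in>Ob C. \<forall>x\<in>pcar Aeps U. pres Aeps (Ident C U) x = x) \<longleftrightarrow> f1_reduced"
proof -
  have "(\<forall>x\<in>pcar Aeps U. pres Aeps (Ident C U) x = x) \<longleftrightarrow> (\<forall>a\<in>carrier (R U). f1 (U, [Ident C U]) [a] = \<zero>\<^bsub>R U\<^esub>)"
    if U: "U \<in> Ob C" for U
  proof -
    interpret r: ring "R U" using ring_R[OF U] .
    have fc: "a \<in> carrier (R U) \<Longrightarrow> f1 (U, [Ident C U]) [a] \<in> carrier (R U)" for a
      using f1_closed[of "Ident C U" U a] U by simp
    show ?thesis using U fc by (auto simp: r.add.l_cancel_one)
  qed
  then have "(\<forall>U\<in>Ob C. \<forall>x\<in>pcar Aeps U. pres Aeps (Ident C U) x = x) \<longleftrightarrow>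
     (\<forall>U\<in>Ob C. \<forall>a\<in>carrier (R U). f1 (U, [Ident C U]) [a] = \<zero>\<^bsub>R U\<^esub>)" by simp
  also have "\<dots> \<longleftrightarrow> f1_reduced"
    unfolding f1_reduced_def
  proof safe
    fix u a assume h: "\<forall>U\<in>Ob C. \<forall>a\<in>carrier (R U). f1 (U, [Ident C U]) [a] = \<zero>\<^bsub>R U\<^esub>"
      and u: "u \<in> Mor C" "u = Ident C (Dom C u)" and a: "a \<in> carrier (R (Cod C u))"
    have "Cod C u = Dom C u" using u by (metis dom_ob ident_cod)
    then show "f1 (Dom C u, [u]) [a] = \<zero>\<^bsub>R (Dom C u)\<^esub>" using h u a by (metis dom_ob)
  next
    fix U a assume h: "\<forall>u\<in>Mor C. u = Ident C (Dom C u) \<longrightarrow> (\<forall>a\<in>carrier (R (Cod C u)). f1 (Dom C u, [u]) [a] = \<zero>\<^bsub>R (Dom C u)\<^esub>)"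
      and U: "U \<in> Ob C" and a: "a \<in> carrier (R U)"
    show "f1 (U, [Ident C U]) [a] = \<zero>\<^bsub>R U\<^esub>" using h[rule_format, of "Ident C U" a] U a by simp
  qed
  finally show ?thesis .
qed

lemma Aeps_twist_unit_iff:
  "(\<forall>u\<in>Mor C. ptw Aeps u (Ident C (Dom C u)) = pone Aeps (Dom C u) \<and>
      ptw Aeps (Ident C (Cod C u)) u = pone Aeps (Dom C u)) \<longleftrightarrow> c1_reduced"
  unfolding c1_reduced_def
proof safe
  fix u v assume h: "\<forall>u\<in>Mor C. ptw Aeps u (Ident C (Dom C u)) = pone Aeps (Dom C u) \<and> ptw Aeps (Ident C (Cod C u)) u = pone Aeps (Dom C u)"
    and uv: "u \<in> Mor C" "v \<in> Mor C" "Cod C v = Dom C u"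
  {
    assume v: "v = Ident C (Dom C v)"
    then have "Dom C v = Dom C u" using uv by (metis dom_ob ident_cod)
    then have "v = Ident C (Dom C u)" using v by simp
    then show "c1 (Dom C v, [v, u]) [] = \<zero>\<^bsub>R (Dom C v)\<^esub>" using h uv by auto
  next
    assume u: "u = Ident C (Dom C u)"
    then have "u = Ident C (Cod C v)" using uv by simp
    then show "c1 (Dom C v, [v, u]) [] = \<zero>\<^bsub>R (Dom C v)\<^esub>" using h uv by auto
  }
next
  fix u assume h: "\<forall>u\<in>Mor C. \<forall>v\<in>Mor C. Cod C v = Dom C u \<longrightarrow> v = Ident C (Dom C v) \<or> u = Ident C (Dom C u) \<longrightarrow>
    c1 (Dom C v, [v, u]) [] = \<zero>\<^bsub>R (Dom C v)\<^esub>" and u: "u \<in> Mor C"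
  show "ptw Aeps u (Ident C (Dom C u)) = pone Aeps (Dom C u)" using h[rule_format, of u "Ident C (Dom C u)"] u by simp
  show "ptw Aeps (Ident C (Cod C u)) u = pone Aeps (Dom C u)" using h[rule_format, of "Ident C (Cod C u)" u] u by simp
qed

lemma Aeps_twist_iff:
  assumes n0: m1_normalized and uv: "u \<in> Mor C" "v \<in> Mor C" "Cod C v = Dom C u"
  shows "ptw Aeps u v \<in> pcar Aeps (Dom C v) \<and> invertible Aeps (Dom C v) (ptw Aeps u v) \<and>
        (\<forall>a\<in>pcar Aeps (Cod C u). pmul Aeps (Dom C v) (ptw Aeps u v) (pres Aeps v (pres Aeps u a)) =
           pmul Aeps (Dom C v) (pres Aeps (Comp C u v) a) (ptw Aeps u v)) \<longleftrightarrow>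
     (\<forall>a\<in>carrier (R (Cod C u)). cocycle_eq_21 u v a)"
proof -
  interpret r: ring "R (Dom C v)" using ring_R uv by simp
  have W: "Dom C v \<in> Ob C" using uv by simp
  have n0': "m1 (Dom C v, []) [\<one>\<^bsub>R (Dom C v)\<^esub>, a] = \<zero>\<^bsub>R (Dom C v)\<^esub>" "m1 (Dom C v, []) [a, \<one>\<^bsub>R (Dom C v)\<^esub>] = \<zero>\<^bsub>R (Dom C v)\<^esub>"
    if "a \<in> carrier (R (Dom C v))" for a using n0 W that unfolding m1_normalized_def by blast+
  have c1_uv: "c1 (Dom C v, [v, u]) [] \<in> carrier (R (Dom C v))" using uv by simp
  have mem: "ptw Aeps u v \<in> pcar Aeps (Dom C v)" using uv by simp
  have inv: "invertible Aeps (Dom C v) (ptw Aeps u v)"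
    unfolding invertible_def
    apply (rule bexI[of _ "(\<one>\<^bsub>R (Dom C v)\<^esub>, \<ominus>\<^bsub>R (Dom C v)\<^esub> c1 (Dom C v, [v, u]) [])"])
    using uv c1_uv by (simp_all add: n0' r.ring_simprules)
  have pc: "pres A (Comp C u v) x = pres A v (pres A u x)" if "x \<in> carrier (R (Cod C u))" for x
    using pres_comp uv that by blast
  have eq: "pmul Aeps (Dom C v) (ptw Aeps u v) (pres Aeps v (pres Aeps u (a, b))) =
           pmul Aeps (Dom C v) (pres Aeps (Comp C u v) (a, b)) (ptw Aeps u v) \<longleftrightarrow> cocycle_eq_21 u v a"
    if ab: "a \<in> carrier (R (Cod C u))" "b \<in> carrier (R (Cod C u))" for a b
  proof -
    let ?X = "pres A v (pres A u a)" and ?c = "c1 (Dom C v, [v, u]) []" and ?B = "pres A v (pres A u b)"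
    have l: "snd (pmul Aeps (Dom C v) (ptw Aeps u v) (pres Aeps v (pres Aeps u (a, b)))) =
       ?B \<oplus>\<^bsub>R (Dom C v)\<^esub> (?c \<otimes>\<^bsub>R (Dom C v)\<^esub> ?X \<oplus>\<^bsub>R (Dom C v)\<^esub> pres A v (f1 (Dom C u, [u]) [a])
      \<oplus>\<^bsub>R (Dom C v)\<^esub> f1 (Dom C v, [v]) [pres A u a])"
      using uv ab by (simp add: n0' r.ring_simprules)
    have r: "snd (pmul Aeps (Dom C v) (pres Aeps (Comp C u v) (a, b)) (ptw Aeps u v)) =
       ?B \<oplus>\<^bsub>R (Dom C v)\<^esub> (?X \<otimes>\<^bsub>R (Dom C v)\<^esub> ?c \<oplus>\<^bsub>R (Dom C v)\<^esub> f1 (Dom C v, [Comp C u v]) [a])"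
      using uv ab by (simp add: n0' r.ring_simprules pc)
    have f: "fst (pmul Aeps (Dom C v) (ptw Aeps u v) (pres Aeps v (pres Aeps u (a, b)))) =
        fst (pmul Aeps (Dom C v) (pres Aeps (Comp C u v) (a, b)) (ptw Aeps u v))"
      using uv ab by (simp add: pc)
    have bc: "?B \<in> carrier (R (Dom C v))" using uv ab by simp
    have x1: "?c \<otimes>\<^bsub>R (Dom C v)\<^esub> ?X \<oplus>\<^bsub>R (Dom C v)\<^esub> pres A v (f1 (Dom C u, [u]) [a])
      \<oplus>\<^bsub>R (Dom C v)\<^esub> f1 (Dom C v, [v]) [pres A u a] \<in> carrier (R (Dom C v))" using uv ab by simp
    have x2: "?X \<otimes>\<^bsub>R (Dom C v)\<^esub> ?c \<oplus>\<^bsub>R (Dom C v)\<^esub> f1 (Dom C v, [Comp C u v]) [a] \<in> carrier (R (Dom C v))"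
      using uv ab by simp
    show ?thesis
      unfolding prod_eq_iff[of "pmul Aeps (Dom C v) (ptw Aeps u v) (pres Aeps v (pres Aeps u (a, b)))"] f l r
      unfolding cocycle_eq_21_def using r.add_left_cancel_iff[OF bc x1 x2] by auto
  qed
  show ?thesis
    using mem inv
    by (simp only: Aeps_simps(1) simp_thms)
      (rule ball_Times_iff_ball_fst[where t = "\<zero>\<^bsub>R (Cod C u)\<^esub>"], erule (1) eq, simp add: uv)
qed

lemma Aeps_twist_cocycle_iff:
  assumes n0: m1_normalized and n1: f1_normalized
    and uvw: "u \<in> Mor C" "v \<in> Mor C" "w \<in> Mor C" "Cod C w = Dom C v" "Cod C v = Dom C u"
  shows "pmul Aeps (Dom C w) (ptw Aeps u (Comp C v w)) (ptw Aeps v w) =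
        pmul Aeps (Dom C w) (ptw Aeps (Comp C u v) w) (pres Aeps w (ptw Aeps u v)) \<longleftrightarrow> cocycle_eq_30 u v w"
proof -
  interpret r: ring "R (Dom C w)" using ring_R uvw by simp
  have W: "Dom C w \<in> Ob C" using uvw by simp
  have n0': "m1 (Dom C w, []) [\<one>\<^bsub>R (Dom C w)\<^esub>, \<one>\<^bsub>R (Dom C w)\<^esub>] = \<zero>\<^bsub>R (Dom C w)\<^esub>"
    using n0 W r.one_closed unfolding m1_normalized_def by blast
  have n1': "f1 (Dom C w, [w]) [\<one>\<^bsub>R (Dom C v)\<^esub>] = \<zero>\<^bsub>R (Dom C w)\<^esub>"
    using n1 uvw unfolding f1_normalized_def by auto
  have l: "pmul Aeps (Dom C w) (ptw Aeps u (Comp C v w)) (ptw Aeps v w) =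
     (\<one>\<^bsub>R (Dom C w)\<^esub>, c1 (Dom C w, [Comp C v w, u]) [] \<oplus>\<^bsub>R (Dom C w)\<^esub> c1 (Dom C w, [w, v]) [])"
    using uvw by (simp add: n0' r.ring_simprules)
  have r: "pmul Aeps (Dom C w) (ptw Aeps (Comp C u v) w) (pres Aeps w (ptw Aeps u v)) =
     (\<one>\<^bsub>R (Dom C w)\<^esub>, pres A w (c1 (Dom C v, [v, u]) []) \<oplus>\<^bsub>R (Dom C w)\<^esub> c1 (Dom C w, [w, Comp C u v]) [])"
    using uvw by (simp add: n0' n1' r.ring_simprules)
  show ?thesis unfolding l r cocycle_eq_30_def by auto
qed

lemma Aeps_is_tw_presheaf_iff:
  "is_tw_presheaf C Aeps \<longleftrightarrow> m1_normalized \<and> f1_normalized \<and> f1_reduced \<and> c1_reduced \<and>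
     cocycle_03 \<and> cocycle_12 \<and> cocycle_21 \<and> cocycle_30"
proof -
  have algebra: "(\<forall>U\<in>Ob C. is_algebra Aeps U) \<longleftrightarrow> m1_normalized \<and> cocycle_03"
    unfolding m1_normalized_def cocycle_03_def using Aeps_is_algebra_iff by blast
  have restriction: "(\<forall>u\<in>Mor C. alg_map Aeps (Cod C u) Aeps (Dom C u) (pres Aeps u)) \<longleftrightarrow>
      f1_normalized \<and> cocycle_12"
    unfolding f1_normalized_def cocycle_12_def using Aeps_restriction_alg_map_iff by blast
  have twist: "m1_normalized \<longrightarrow> (\<forall>u\<in>Mor C. \<forall>v\<in>Mor C. Cod C v = Dom C u \<longrightarrow>
        ptw Aeps u v \<in> pcar Aeps (Dom C v) \<and> invertible Aeps (Dom C v) (ptw Aeps u v) \<and>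
        (\<forall>a\<in>pcar Aeps (Cod C u).
           pmul Aeps (Dom C v) (ptw Aeps u v) (pres Aeps v (pres Aeps u a)) =
           pmul Aeps (Dom C v) (pres Aeps (Comp C u v) a) (ptw Aeps u v))) \<longleftrightarrow> cocycle_21"
    unfolding cocycle_21_def using Aeps_twist_iff by blast
  have twist_cocycle: "m1_normalized \<and> f1_normalized \<longrightarrow>
      (\<forall>u\<in>Mor C. \<forall>v\<in>Mor C. \<forall>w\<in>Mor C. Cod C w = Dom C v \<and> Cod C v = Dom C u \<longrightarrow>
        pmul Aeps (Dom C w) (ptw Aeps u (Comp C v w)) (ptw Aeps v w) =
        pmul Aeps (Dom C w) (ptw Aeps (Comp C u v) w) (pres Aeps w (ptw Aeps u v))) \<longleftrightarrow> cocycle_30"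
    unfolding cocycle_30_def using Aeps_twist_cocycle_iff by blast
  show ?thesis
    unfolding is_tw_presheaf_def
    using algebra restriction Aeps_restriction_ident_iff Aeps_twist_unit_iff twist twist_cocycle by argo
qed

theorem is_tw_deformation_iff:
  "is_tw_deformation C A m1 f1 c1 \<longleftrightarrow>
     NR C A 2 (pack3 m1 f1 c1) \<and> ceq C A 3 (dGS C A 2 (pack3 m1 f1 c1)) (czero A)"
  unfolding is_tw_deformation_def Aeps_is_tw_presheaf_iff NR2_iff dGS2_eq_zero_iff
  using m1_cochain f1_cochain c1_cochain by blast
end

lemma (in gs_presheaf) first_order_data_if_Z2:
  assumes "(m1, f1, c1) \<in> Z2 C A"
  shows "first_order_data C A m1 f1 c1"
proof -
  have "cochain_pq C A 0 2 m1" "cochain_pq C A 1 1 f1" "cochain_pq C A 2 0 c1"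
    using assms unfolding Z2_def NR_def cochain_pack3_iff by blast+
  then show ?thesis by unfold_locales
qed

section \<open>Equivalences of deformations and 1-coboundaries\<close>

locale cocycle_pair = gs_presheaf C A
  for C :: "('o,'m) cat" and A :: "('o,'m,'a,'k::comm_ring_1) tpsh" +
  fixes m1 f1 c1 m1' f1' c1' :: "('o,'m,'a) cochn"
  assumes cocycle: "(m1, f1, c1) \<in> Z2 C A" and cocycle': "(m1', f1', c1') \<in> Z2 C A"
begin

sublocale D: first_order_data C A m1 f1 c1
  using first_order_data_if_Z2[OF cocycle] .

sublocale D': first_order_data C A m1' f1' c1'
  using first_order_data_if_Z2[OF cocycle'] .

lemma D'_normalized: "D'.m1_normalized" "D'.f1_normalized"
  using cocycle' D'.NR2_iff unfolding Z2_def by blast+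

definition g_normalized :: "('o,'m,'a) cochn \<Rightarrow> bool" where
  "g_normalized g \<longleftrightarrow> (\<forall>U\<in>Ob C. g (U, []) [\<one>\<^bsub>R U\<^esub>] = \<zero>\<^bsub>R U\<^esub>)"

definition reduced_10 :: "('o,'m,'a) cochn \<Rightarrow> bool" where
  "reduced_10 t \<longleftrightarrow> (\<forall>u\<in>Mor C. u = Ident C (Dom C u) \<longrightarrow> t (Dom C u, [u]) [] = \<zero>\<^bsub>R (Dom C u)\<^esub>)"

text \<open>The components of \<open>d\<^sub>G\<^sub>S (g, t) = (m1, f1, c1) - (m1', f1', c1')\<close> in bidegrees
  (0,2), (1,1) and (2,0), with the subtracted terms moved across.\<close>

definition coboundary_eq_02 :: "('o,'m,'a) cochn \<Rightarrow> 'o \<Rightarrow> 'a \<Rightarrow> 'a \<Rightarrow> bool" where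
  "coboundary_eq_02 g U a b \<longleftrightarrow>
     a \<otimes>\<^bsub>R U\<^esub> g (U, []) [b]
       \<oplus>\<^bsub>R U\<^esub> g (U, []) [a] \<otimes>\<^bsub>R U\<^esub> b \<oplus>\<^bsub>R U\<^esub> m1' (U, []) [a, b] =
     m1 (U, []) [a, b] \<oplus>\<^bsub>R U\<^esub> g (U, []) [a \<otimes>\<^bsub>R U\<^esub> b]"

definition coboundary_eq_11 :: "('o,'m,'a) cochn \<Rightarrow> ('o,'m,'a) cochn \<Rightarrow> 'm \<Rightarrow> 'a \<Rightarrow> bool" where
  "coboundary_eq_11 g t u a \<longleftrightarrow>
     pres A u a \<otimes>\<^bsub>R (Dom C u)\<^esub> t (Dom C u, [u]) [] \<oplus>\<^bsub>R (Dom C u)\<^esub> pres A u (g (Cod C u, []) [a])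
       \<oplus>\<^bsub>R (Dom C u)\<^esub> f1' (Dom C u, [u]) [a] =
     f1 (Dom C u, [u]) [a] \<oplus>\<^bsub>R (Dom C u)\<^esub>
       (t (Dom C u, [u]) [] \<otimes>\<^bsub>R (Dom C u)\<^esub> pres A u a \<oplus>\<^bsub>R (Dom C u)\<^esub> g (Dom C u, []) [pres A u a])"

definition coboundary_eq_20 :: "('o,'m,'a) cochn \<Rightarrow> 'm \<Rightarrow> 'm \<Rightarrow> bool" where
  "coboundary_eq_20 t u v \<longleftrightarrow>
     pres A v (t (Dom C u, [u]) []) \<oplus>\<^bsub>R (Dom C v)\<^esub> t (Dom C v, [v]) [] \<oplus>\<^bsub>R (Dom C v)\<^esub> c1' (Dom C v, [v, u]) [] =
     c1 (Dom C v, [v, u]) [] \<oplus>\<^bsub>R (Dom C v)\<^esub> t (Dom C v, [Comp C u v]) []"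

definition coboundary_02 :: "('o,'m,'a) cochn \<Rightarrow> bool" where
  "coboundary_02 g \<longleftrightarrow> (\<forall>U\<in>Ob C. \<forall>a\<in>carrier (R U). \<forall>b\<in>carrier (R U). coboundary_eq_02 g U a b)"

definition coboundary_11 :: "('o,'m,'a) cochn \<Rightarrow> ('o,'m,'a) cochn \<Rightarrow> bool" where
  "coboundary_11 g t \<longleftrightarrow> (\<forall>u\<in>Mor C. \<forall>a\<in>carrier (R (Cod C u)). coboundary_eq_11 g t u a)"

definition coboundary_20 :: "('o,'m,'a) cochn \<Rightarrow> bool" where
  "coboundary_20 t \<longleftrightarrow> (\<forall>u\<in>Mor C. \<forall>v\<in>Mor C. Cod C v = Dom C u \<longrightarrow> coboundary_eq_20 t u v)"

lemma cochain01_linear: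
  assumes g: "cochain_pq C A 0 1 g" and U: "U \<in> Ob C"
  shows "a \<in> carrier (R U) \<Longrightarrow> g (U, []) [a] \<in> carrier (R U)"
    "a \<in> carrier (R U) \<Longrightarrow> b \<in> carrier (R U) \<Longrightarrow> g (U, []) [a
      \<oplus>\<^bsub>R U\<^esub> b] = g (U, []) [a] \<oplus>\<^bsub>R U\<^esub> g (U, []) [b]"
    "a \<in> carrier (R U) \<Longrightarrow> g (U, []) [psmult A U r a] = psmult A U r (g (U, []) [a])"
    "a \<in> carrier (R U) \<Longrightarrow> g (U, []) [\<ominus>\<^bsub>R U\<^esub> a] = \<ominus>\<^bsub>R U\<^esub> g (U, []) [a]"
    "g (U, []) [\<zero>\<^bsub>R U\<^esub>] = \<zero>\<^bsub>R U\<^esub>"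
  using mlin1D[of U U "g (U, [])"] g U unfolding cochain_pq0_iff by blast+

lemma cochain10_closed: "cochain_pq C A 1 0 t \<Longrightarrow> u \<in> Mor C \<Longrightarrow> V = Dom C u \<Longrightarrow> t (V, [u]) [] \<in> carrier (R V)"
  unfolding cochain_pq1_iff mlin0 by blast

lemma dGS1_02_eq_iff:
  assumes g: "cochain_pq C A 0 1 g" and U: "U \<in> Ob C" and ab: "a \<in> carrier (R U)" "b \<in> carrier (R U)"
  shows "(dGS C A 1 (pack2 g t) 0 (U, []) [a, b] = csub A (pack3 m1 f1 c1) (pack3 m1' f1' c1') 0 (U, []) [a, b])
    \<longleftrightarrow> coboundary_eq_02 g U a b"
proof -
  interpret r: ring "R U" using ring_R[OF U] .
  note gf = cochain01_linear[OF g U]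
  have gc: "g (U, []) [a \<otimes>\<^bsub>R U\<^esub> b] \<in> carrier (R U)" using gf ab by simp
  have e1: "dGS C A 1 (pack2 g t) 0 (U, []) [a, b] =
     (a \<otimes>\<^bsub>R U\<^esub> g (U, []) [b] \<oplus>\<^bsub>R U\<^esub> g (U, []) [a] \<otimes>\<^bsub>R U\<^esub> b)
       \<oplus>\<^bsub>R U\<^esub> \<ominus>\<^bsub>R U\<^esub> g (U, []) [a \<otimes>\<^bsub>R U\<^esub> b]"
    using ab U gf gc
    by (simp add: dGS_expand pack2_def) (simp add: r.ring_simprules)
  have e2: "csub A (pack3 m1 f1 c1) (pack3 m1' f1' c1') 0 (U, []) [a, b] = m1 (U, []) [a, b]
    \<oplus>\<^bsub>R U\<^esub> \<ominus>\<^bsub>R U\<^esub> m1' (U, []) [a, b]"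
    using ab U by (simp add: csub_def pack3_def ring_of_simps)
  show ?thesis unfolding e1 e2 coboundary_eq_02_def
    using ab U gf gc by (simp add: r.diff_eq_diff_iff)
qed

lemma dGS1_11_eq_iff:
  assumes g: "cochain_pq C A 0 1 g" and t: "cochain_pq C A 1 0 t" and u: "u \<in> Mor C" and a: "a \<in> carrier (R (Cod C u))"
  shows "(dGS C A 1 (pack2 g t) 1 (Dom C u, [u]) [a] = csub A (pack3 m1 f1 c1) (pack3 m1' f1' c1') 1 (Dom C u, [u]) [a])
    \<longleftrightarrow> coboundary_eq_11 g t u a"
proof -
  interpret r: ring "R (Dom C u)" using ring_R u by simp
  have U: "Dom C u \<in> Ob C" "Cod C u \<in> Ob C" using u by simp_all
  note gf = cochain01_linear[OF g U(1)] cochain01_linear[OF g U(2)]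
  have tc: "t (Dom C u, [u]) [] \<in> carrier (R (Dom C u))" using cochain10_closed[OF t u] by simp
  have e1: "dGS C A 1 (pack2 g t) 1 (Dom C u, [u]) [a] =
     (pres A u a \<otimes>\<^bsub>R (Dom C u)\<^esub> t (Dom C u, [u]) []
       \<oplus>\<^bsub>R (Dom C u)\<^esub> pres A u (g (Cod C u, []) [a])) \<oplus>\<^bsub>R (Dom C u)\<^esub>
     \<ominus>\<^bsub>R (Dom C u)\<^esub> (t (Dom C u, [u]) [] \<otimes>\<^bsub>R (Dom C u)\<^esub> pres A u a
       \<oplus>\<^bsub>R (Dom C u)\<^esub> g (Dom C u, []) [pres A u a])"
    using a u gf tc
    by (simp add: dGS_expand pack2_def) (simp add: r.ring_simprules)
  have e2: "csub A (pack3 m1 f1 c1) (pack3 m1' f1' c1') 1 (Dom C u, [u]) [a] =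
      f1 (Dom C u, [u]) [a] \<oplus>\<^bsub>R (Dom C u)\<^esub> \<ominus>\<^bsub>R (Dom C u)\<^esub> f1' (Dom C u, [u]) [a]"
    using a u by (simp add: csub_def pack3_def ring_of_simps)
  show ?thesis unfolding e1 e2 coboundary_eq_11_def
    using a u gf tc by (simp add: r.diff_eq_diff_iff)
qed

lemma dGS1_20_eq_iff:
  assumes t: "cochain_pq C A 1 0 t" and uv: "u \<in> Mor C" "v \<in> Mor C" "Cod C v = Dom C u"
  shows "(dGS C A 1 (pack2 g t) 2 (Dom C v, [v, u]) [] = csub A (pack3 m1 f1 c1) (pack3 m1' f1' c1') 2 (Dom C v, [v, u]) [])
    \<longleftrightarrow> coboundary_eq_20 t u v"
proof -
  interpret r: ring "R (Dom C v)" using ring_R uv by simp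
  note tc = cochain10_closed[OF t]
  have e1: "dGS C A 1 (pack2 g t) 2 (Dom C v, [v, u]) [] =
     (pres A v (t (Dom C u, [u]) []) \<oplus>\<^bsub>R (Dom C v)\<^esub> t (Dom C v, [v]) [])
       \<oplus>\<^bsub>R (Dom C v)\<^esub> \<ominus>\<^bsub>R (Dom C v)\<^esub> t (Dom C v, [Comp C u v]) []"
    using uv
    by (simp add: dGS_expand pack2_def tc) (simp add: r.ring_simprules tc)
  have e2: "csub A (pack3 m1 f1 c1) (pack3 m1' f1' c1') 2 (Dom C v, [v, u]) [] =
      c1 (Dom C v, [v, u]) [] \<oplus>\<^bsub>R (Dom C v)\<^esub> \<ominus>\<^bsub>R (Dom C v)\<^esub> c1' (Dom C v, [v, u]) []"
    using uv by (simp add: csub_def pack3_def ring_of_simps)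
  show ?thesis unfolding e1 e2 coboundary_eq_20_def
    using uv by (simp add: r.diff_eq_diff_iff tc)
qed

lemma NR1_dGS1_eq_iff:
  assumes g: "cochain_pq C A 0 1 g" and t: "cochain_pq C A 1 0 t"
  shows "NR C A 1 (pack2 g t) \<and> ceq C A 2 (dGS C A 1 (pack2 g t)) (csub A (pack3 m1 f1 c1) (pack3 m1' f1' c1'))
    \<longleftrightarrow> g_normalized g \<and> reduced_10 t \<and> coboundary_02 g \<and> coboundary_11 g t \<and> coboundary_20 t"
proof -
  have cochain: "cochain C A 1 (pack2 g t)"
    unfolding cochain_def all_le_1 pack2_def using g t by simp
  have normalized: "normalized C A 1 (pack2 g t) \<longleftrightarrow> g_normalized g"
    unfolding normalized_def all_le_1 pack2_def g_normalized_def
    by (auto simp del: One_nat_def simp: ball_nerve0 ball_nerve1 ball_nerve_Suc_0 ball_args0 ball_args1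
        ball_args_Suc_0 ex_less_Suc_0 ring_of_simps)
  have reduced: "reduced C A 1 (pack2 g t) \<longleftrightarrow> reduced_10 t"
    unfolding reduced_def all_le_1 pack2_def reduced_10_def
    by (auto simp del: One_nat_def simp: ball_nerve0 ball_nerve1 ball_nerve_Suc_0 ball_args0 ball_args1
        ball_args_Suc_0 degenerate_def nerve0_iff ring_of_simps)
  have "ceq C A 2 (dGS C A 1 (pack2 g t)) (csub A (pack3 m1 f1 c1) (pack3 m1' f1' c1')) \<longleftrightarrow>
      coboundary_02 g \<and> coboundary_11 g t \<and> coboundary_20 t"
    unfolding ceq_def all_le_2 coboundary_02_def coboundary_11_def coboundary_20_def
    by (simp del: One_nat_def add: ball_nerve0 ball_nerve1 ball_nerve_Suc_0 ball_nerve2 ball_args0 ball_args1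
        ball_args_Suc_0 ball_args2 dGS1_02_eq_iff[OF g] dGS1_11_eq_iff[OF g t] dGS1_20_eq_iff[OF t])
  then show ?thesis unfolding NR_def using cochain normalized reduced by blast
qed

lemma g_of_simp[simp]: "g_of A g U (a, b) = (a, b \<oplus>\<^bsub>ring_of A U\<^esub> g (U, []) [a])"
  by (simp add: g_of_def ring_of_simps)
lemma tau_of_simp[simp]: "tau_of C A \<tau> u = (\<one>\<^bsub>ring_of A (Dom C u)\<^esub>, \<tau> (Dom C u, [u]) [])"
  by (simp add: tau_of_def ring_of_simps)

text \<open>The morphism axioms for \<open>(1 + g \<epsilon>, 1 + \<tau> \<epsilon>)\<close>, read off in the \<open>\<epsilon>\<close>-component.\<close>

definition intertwining_eq :: "('o,'m,'a) cochn \<Rightarrow> ('o,'m,'a) cochn \<Rightarrow> 'm \<Rightarrow> 'a \<Rightarrow> bool" where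
  "intertwining_eq g \<tau> u a \<longleftrightarrow>
     f1 (Dom C u, [u]) [a] \<oplus>\<^bsub>R (Dom C u)\<^esub> g (Dom C u, []) [pres A u a]
       \<oplus>\<^bsub>R (Dom C u)\<^esub> pres A u a \<otimes>\<^bsub>R (Dom C u)\<^esub> \<tau> (Dom C u, [u]) [] =
     pres A u (g (Cod C u, []) [a]) \<oplus>\<^bsub>R (Dom C u)\<^esub> f1' (Dom C u, [u]) [a]
       \<oplus>\<^bsub>R (Dom C u)\<^esub> \<tau> (Dom C u, [u]) [] \<otimes>\<^bsub>R (Dom C u)\<^esub> pres A u a"

definition twist_compat_eq :: "('o,'m,'a) cochn \<Rightarrow> 'm \<Rightarrow> 'm \<Rightarrow> bool" where
  "twist_compat_eq \<tau> u v \<longleftrightarrow>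
     \<tau> (Dom C v, [Comp C u v]) [] \<oplus>\<^bsub>R (Dom C v)\<^esub> c1' (Dom C v, [v, u]) [] =
     c1 (Dom C v, [v, u]) [] \<oplus>\<^bsub>R (Dom C v)\<^esub> \<tau> (Dom C v, [v]) [] \<oplus>\<^bsub>R (Dom C v)\<^esub> pres A v (\<tau> (Dom C u, [u]) [])"

definition intertwining :: "('o,'m,'a) cochn \<Rightarrow> ('o,'m,'a) cochn \<Rightarrow> bool" where
  "intertwining g \<tau> \<longleftrightarrow> (\<forall>u\<in>Mor C. \<forall>a\<in>carrier (R (Cod C u)). intertwining_eq g \<tau> u a)"

definition twist_compat :: "('o,'m,'a) cochn \<Rightarrow> bool" where
  "twist_compat \<tau> \<longleftrightarrow> (\<forall>u\<in>Mor C. \<forall>v\<in>Mor C. Cod C v = Dom C u \<longrightarrow> twist_compat_eq \<tau> u v)"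

definition tau_unital :: "('o,'m,'a) cochn \<Rightarrow> bool" where
  "tau_unital \<tau> \<longleftrightarrow> (\<forall>U\<in>Ob C. \<tau> (U, [Ident C U]) [] = \<zero>\<^bsub>R U\<^esub>)"

lemma g_of_mult:
  assumes g: "cochain_pq C A 0 1 g" and U: "U \<in> Ob C"
    and coboundary: "\<forall>a\<in>carrier (R U). \<forall>b\<in>carrier (R U). coboundary_eq_02 g U a b"
    and xy: "x \<in> pcar D.Aeps U" "y \<in> pcar D.Aeps U"
  shows "g_of A g U (pmul D.Aeps U x y) = pmul D'.Aeps U (g_of A g U x) (g_of A g U y)"
proof -
  interpret r: ring "R U" using ring_R[OF U] .
  note gf = cochain01_linear[OF g U]
  obtain a b a' b' where x: "x = (a, b)" and y: "y = (a', b')" by (cases x, cases y)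
  have c: "a \<in> carrier (R U)" "b \<in> carrier (R U)" "a' \<in> carrier (R U)" "b' \<in> carrier (R U)"
    using xy x y by auto
  have E: "m1 (U, []) [a, a'] \<oplus>\<^bsub>R U\<^esub> g (U, []) [a \<otimes>\<^bsub>R U\<^esub> a'] =
     a \<otimes>\<^bsub>R U\<^esub> g (U, []) [a']
       \<oplus>\<^bsub>R U\<^esub> g (U, []) [a] \<otimes>\<^bsub>R U\<^esub> a' \<oplus>\<^bsub>R U\<^esub> m1' (U, []) [a, a']"
    using coboundary c unfolding coboundary_eq_02_def by auto
  have s1: "(a \<otimes>\<^bsub>R U\<^esub> b' \<oplus>\<^bsub>R U\<^esub> b \<otimes>\<^bsub>R U\<^esub> a')
    \<oplus>\<^bsub>R U\<^esub> m1 (U, []) [a, a'] \<oplus>\<^bsub>R U\<^esub> g (U, []) [a \<otimes>\<^bsub>R U\<^esub> a'] =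
    (a \<otimes>\<^bsub>R U\<^esub> b' \<oplus>\<^bsub>R U\<^esub> b \<otimes>\<^bsub>R U\<^esub> a')
      \<oplus>\<^bsub>R U\<^esub> (m1 (U, []) [a, a'] \<oplus>\<^bsub>R U\<^esub> g (U, []) [a \<otimes>\<^bsub>R U\<^esub> a'])"
    using c U gf by (simp add: r.ring_simprules)
  have s2: "a \<otimes>\<^bsub>R U\<^esub> (b' \<oplus>\<^bsub>R U\<^esub> g (U, []) [a']) \<oplus>\<^bsub>R U\<^esub> (b
    \<oplus>\<^bsub>R U\<^esub> g (U, []) [a]) \<otimes>\<^bsub>R U\<^esub> a' \<oplus>\<^bsub>R U\<^esub> m1' (U, []) [a, a'] =
    (a \<otimes>\<^bsub>R U\<^esub> b' \<oplus>\<^bsub>R U\<^esub> b \<otimes>\<^bsub>R U\<^esub> a')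
      \<oplus>\<^bsub>R U\<^esub> (a \<otimes>\<^bsub>R U\<^esub> g (U, []) [a']
      \<oplus>\<^bsub>R U\<^esub> g (U, []) [a] \<otimes>\<^bsub>R U\<^esub> a' \<oplus>\<^bsub>R U\<^esub> m1' (U, []) [a, a'])"
    using c U gf by (simp add: r.ring_simprules)
  show ?thesis
    unfolding x y D.Aeps_simps D'.Aeps_simps g_of_simp s1 s2 E by simp
qed

lemma g_of_alg_map_iff:
  assumes g: "cochain_pq C A 0 1 g" and U: "U \<in> Ob C"
  shows "alg_map D.Aeps U D'.Aeps U (g_of A g U) \<longleftrightarrow> g (U, []) [\<one>\<^bsub>R U\<^esub>] = \<zero>\<^bsub>R U\<^esub> \<and>
     (\<forall>a\<in>carrier (R U). \<forall>b\<in>carrier (R U). coboundary_eq_02 g U a b)"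
proof -
  interpret r: ring "R U" using ring_R[OF U] .
  note gf = cochain01_linear[OF g U]
  show ?thesis
  proof
    assume h: "alg_map D.Aeps U D'.Aeps U (g_of A g U)"
    have "coboundary_eq_02 g U a b" if ab: "a \<in> carrier (R U)" "b \<in> carrier (R U)" for a b
    proof -
      have "g_of A g U (pmul D.Aeps U (a, \<zero>\<^bsub>R U\<^esub>) (b, \<zero>\<^bsub>R U\<^esub>)) =
            pmul D'.Aeps U (g_of A g U (a, \<zero>\<^bsub>R U\<^esub>)) (g_of A g U (b, \<zero>\<^bsub>R U\<^esub>))"
        by (rule alg_map_multD[OF h]) (simp_all add: ab U)
      then show ?thesis using ab U gf unfolding coboundary_eq_02_def by (simp add: r.ring_simprules)
    qed
    then show "g (U, []) [\<one>\<^bsub>R U\<^esub>] = \<zero>\<^bsub>R U\<^esub> \<and>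
        (\<forall>a\<in>carrier (R U). \<forall>b\<in>carrier (R U). coboundary_eq_02 g U a b)"
      using alg_map_oneD[OF h] U gf by (simp add: r.ring_simprules)
  next
    assume h: "g (U, []) [\<one>\<^bsub>R U\<^esub>] = \<zero>\<^bsub>R U\<^esub> \<and>
      (\<forall>a\<in>carrier (R U). \<forall>b\<in>carrier (R U). coboundary_eq_02 g U a b)"
    show "alg_map D.Aeps U D'.Aeps U (g_of A g U)"
    proof (rule alg_mapI)
      show "g_of A g U (pmul D.Aeps U x y) = pmul D'.Aeps U (g_of A g U x) (g_of A g U y)"
        if "x \<in> pcar D.Aeps U" "y \<in> pcar D.Aeps U" for x y
        using g_of_mult[OF g U _ that] h by blast
    qed (use h U gf in \<open>auto simp: r.ring_simprules smult_laws[OF U]\<close>)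
  qed
qed

lemma g_of_bij:
  assumes g: "cochain_pq C A 0 1 g" and U: "U \<in> Ob C"
  shows "bij_betw (g_of A g U) (pcar D.Aeps U) (pcar D'.Aeps U)"
proof -
  interpret r: ring "R U" using ring_R[OF U] .
  note gf = cochain01_linear[OF g U]
  show ?thesis
    apply (rule bij_betw_byWitness[where f'="\<lambda>(a, b). (a, b \<oplus>\<^bsub>R U\<^esub> \<ominus>\<^bsub>R U\<^esub> g (U, []) [a])"])
    using gf by (auto simp: r.ring_simprules)
qed

lemma tau_of_intertwines_iff:
  assumes g: "cochain_pq C A 0 1 g" and t: "cochain_pq C A 1 0 \<tau>" and u: "u \<in> Mor C"
  shows "tau_of C A \<tau> u \<in> pcar D'.Aeps (Dom C u) \<and> invertible D'.Aeps (Dom C u) (tau_of C A \<tau> u) \<and>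
        (\<forall>a\<in>pcar D.Aeps (Cod C u).
           pmul D'.Aeps (Dom C u) (g_of A g (Dom C u) (pres D.Aeps u a)) (tau_of C A \<tau> u) =
           pmul D'.Aeps (Dom C u) (tau_of C A \<tau> u) (pres D'.Aeps u (g_of A g (Cod C u) a)))
     \<longleftrightarrow> (\<forall>a\<in>carrier (R (Cod C u)). intertwining_eq g \<tau> u a)"
proof -
  interpret r: ring "R (Dom C u)" using ring_R u by simp
  have U: "Dom C u \<in> Ob C" "Cod C u \<in> Ob C" using u by simp_all
  note gf = cochain01_linear[OF g U(1)] cochain01_linear[OF g U(2)]
  have n0': "m1' (Dom C u, []) [\<one>\<^bsub>R (Dom C u)\<^esub>, a] = \<zero>\<^bsub>R (Dom C u)\<^esub>" "m1' (Dom C u, []) [a, \<one>\<^bsub>R (Dom C u)\<^esub>] = \<zero>\<^bsub>R (Dom C u)\<^esub>"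
    if "a \<in> carrier (R (Dom C u))" for a using D'_normalized(1) U that unfolding D'.m1_normalized_def by blast+
  have tc: "\<tau> (Dom C u, [u]) [] \<in> carrier (R (Dom C u))" using cochain10_closed[OF t u] by simp
  have mem: "tau_of C A \<tau> u \<in> pcar D'.Aeps (Dom C u)" using u tc by simp
  have inv: "invertible D'.Aeps (Dom C u) (tau_of C A \<tau> u)"
    unfolding invertible_def
    apply (rule bexI[of _ "(\<one>\<^bsub>R (Dom C u)\<^esub>, \<ominus>\<^bsub>R (Dom C u)\<^esub> \<tau> (Dom C u, [u]) [])"])
    using u tc by (simp_all add: n0' r.ring_simprules)
  have eq: "pmul D'.Aeps (Dom C u) (g_of A g (Dom C u) (pres D.Aeps u (a, b))) (tau_of C A \<tau> u) =
           pmul D'.Aeps (Dom C u) (tau_of C A \<tau> u) (pres D'.Aeps u (g_of A g (Cod C u) (a, b))) \<longleftrightarrow> intertwining_eq g \<tau> u a"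
    if ab: "a \<in> carrier (R (Cod C u))" "b \<in> carrier (R (Cod C u))" for a b
  proof -
    let ?t = "\<tau> (Dom C u, [u]) []" and ?B = "pres A u b"
    have l: "snd (pmul D'.Aeps (Dom C u) (g_of A g (Dom C u) (pres D.Aeps u (a, b))) (tau_of C A \<tau> u)) =
       ?B \<oplus>\<^bsub>R (Dom C u)\<^esub> (f1 (Dom C u, [u]) [a] \<oplus>\<^bsub>R (Dom C u)\<^esub> g (Dom C u, []) [pres A u a]
         \<oplus>\<^bsub>R (Dom C u)\<^esub> pres A u a \<otimes>\<^bsub>R (Dom C u)\<^esub> ?t)"
      using u ab tc gf by (simp add: n0' r.ring_simprules)
    have r: "snd (pmul D'.Aeps (Dom C u) (tau_of C A \<tau> u) (pres D'.Aeps u (g_of A g (Cod C u) (a, b)))) =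
       ?B \<oplus>\<^bsub>R (Dom C u)\<^esub> (pres A u (g (Cod C u, []) [a]) \<oplus>\<^bsub>R (Dom C u)\<^esub> f1' (Dom C u, [u]) [a]
         \<oplus>\<^bsub>R (Dom C u)\<^esub> ?t \<otimes>\<^bsub>R (Dom C u)\<^esub> pres A u a)"
      using u ab tc gf by (simp add: n0' r.ring_simprules)
    have f: "fst (pmul D'.Aeps (Dom C u) (g_of A g (Dom C u) (pres D.Aeps u (a, b))) (tau_of C A \<tau> u)) =
        fst (pmul D'.Aeps (Dom C u) (tau_of C A \<tau> u) (pres D'.Aeps u (g_of A g (Cod C u) (a, b))))"
      using u ab tc gf by simp
    have bc: "?B \<in> carrier (R (Dom C u))" using u ab by simp
    have x1: "f1 (Dom C u, [u]) [a] \<oplus>\<^bsub>R (Dom C u)\<^esub> g (Dom C u, []) [pres A u a]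
      \<oplus>\<^bsub>R (Dom C u)\<^esub> pres A u a \<otimes>\<^bsub>R (Dom C u)\<^esub> ?t
       \<in> carrier (R (Dom C u))" using u ab tc gf by simp
    have x2: "pres A u (g (Cod C u, []) [a]) \<oplus>\<^bsub>R (Dom C u)\<^esub> f1' (Dom C u, [u]) [a]
      \<oplus>\<^bsub>R (Dom C u)\<^esub> ?t \<otimes>\<^bsub>R (Dom C u)\<^esub> pres A u a
       \<in> carrier (R (Dom C u))" using u ab tc gf by simp
    show ?thesis
      unfolding prod_eq_iff[of "pmul D'.Aeps (Dom C u) (g_of A g (Dom C u) (pres D.Aeps u (a, b))) (tau_of C A \<tau> u)"] f l r
      unfolding intertwining_eq_def using r.add_left_cancel_iff[OF bc x1 x2] by auto
  qed
  show ?thesis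
    using mem inv
    by (simp only: D.Aeps_simps(1) simp_thms)
      (rule ball_Times_iff_ball_fst[where t = "\<zero>\<^bsub>R (Cod C u)\<^esub>"], erule (1) eq, simp add: u)
qed

lemma tau_of_twist_iff:
  assumes g: "cochain_pq C A 0 1 g" and t: "cochain_pq C A 1 0 \<tau>" and g0: "g_normalized g"
    and uv: "u \<in> Mor C" "v \<in> Mor C" "Cod C v = Dom C u"
  shows "pmul D'.Aeps (Dom C v) (tau_of C A \<tau> (Comp C u v)) (ptw D'.Aeps u v) =
        pmul D'.Aeps (Dom C v) (pmul D'.Aeps (Dom C v) (g_of A g (Dom C v) (ptw D.Aeps u v)) (tau_of C A \<tau> v)) (pres D'.Aeps v (tau_of C A \<tau> u))
     \<longleftrightarrow> twist_compat_eq \<tau> u v"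
proof -
  interpret r: ring "R (Dom C v)" using ring_R uv by simp
  have W: "Dom C v \<in> Ob C" using uv by simp
  have n0': "m1' (Dom C v, []) [\<one>\<^bsub>R (Dom C v)\<^esub>, \<one>\<^bsub>R (Dom C v)\<^esub>] = \<zero>\<^bsub>R (Dom C v)\<^esub>"
    using D'_normalized(1) W r.one_closed unfolding D'.m1_normalized_def by blast
  have n1': "f1' (Dom C v, [v]) [\<one>\<^bsub>R (Dom C u)\<^esub>] = \<zero>\<^bsub>R (Dom C v)\<^esub>"
    using D'_normalized(2) uv unfolding D'.f1_normalized_def by auto
  have g0': "g (Dom C v, []) [\<one>\<^bsub>R (Dom C v)\<^esub>] = \<zero>\<^bsub>R (Dom C v)\<^esub>" using g0 W unfolding g_normalized_def by blast
  note tc = cochain10_closed[OF t]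
  have l: "pmul D'.Aeps (Dom C v) (tau_of C A \<tau> (Comp C u v)) (ptw D'.Aeps u v) =
     (\<one>\<^bsub>R (Dom C v)\<^esub>, \<tau> (Dom C v, [Comp C u v]) [] \<oplus>\<^bsub>R (Dom C v)\<^esub> c1' (Dom C v, [v, u]) [])"
    using uv by (simp add: n0' r.ring_simprules tc)
  have r: "pmul D'.Aeps (Dom C v) (pmul D'.Aeps (Dom C v) (g_of A g (Dom C v) (ptw D.Aeps u v)) (tau_of C A \<tau> v)) (pres D'.Aeps v (tau_of C A \<tau> u)) =
     (\<one>\<^bsub>R (Dom C v)\<^esub>, c1 (Dom C v, [v, u]) [] \<oplus>\<^bsub>R (Dom C v)\<^esub> \<tau> (Dom C v, [v]) []
       \<oplus>\<^bsub>R (Dom C v)\<^esub> pres A v (\<tau> (Dom C u, [u]) []))"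
    using uv by (simp add: n0' n1' g0' r.ring_simprules tc)
  show ?thesis unfolding l r twist_compat_eq_def by simp
qed

lemma g_of_natural_iff:
  assumes g: "cochain_pq C A 0 1 g" and u: "u \<in> Mor C"
  shows "(\<forall>x\<in>pcar D.Aeps (Cod C u).
      g_of A g (Dom C u) (pres D.Aeps u x) = pres D'.Aeps u (g_of A g (Cod C u) x)) \<longleftrightarrow>
    (\<forall>a\<in>carrier (R (Cod C u)). coboundary_eq_11 g (czero1 A) u a)"
proof -
  interpret r: ring "R (Dom C u)" using ring_R u by simp
  have U: "Dom C u \<in> Ob C" "Cod C u \<in> Ob C" using u by simp_all
  note gf = cochain01_linear[OF g U(1)] cochain01_linear[OF g U(2)]
  have eq: "g_of A g (Dom C u) (pres D.Aeps u (a, b)) = pres D'.Aeps u (g_of A g (Cod C u) (a, b)) \<longleftrightarrow> coboundary_eq_11 g (czero1 A) u a"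
    if ab: "a \<in> carrier (R (Cod C u))" "b \<in> carrier (R (Cod C u))" for a b
  proof -
    have bc: "pres A u b \<in> carrier (R (Dom C u))" using u ab by simp
    have x1: "f1 (Dom C u, [u]) [a] \<oplus>\<^bsub>R (Dom C u)\<^esub> g (Dom C u, []) [pres A u a] \<in> carrier (R (Dom C u))"
      using u ab gf by simp
    have x2: "pres A u (g (Cod C u, []) [a]) \<oplus>\<^bsub>R (Dom C u)\<^esub> f1' (Dom C u, [u]) [a] \<in> carrier (R (Dom C u))"
      using u ab gf by simp
    have l: "g_of A g (Dom C u) (pres D.Aeps u (a, b)) = (pres A u a, pres A u b
      \<oplus>\<^bsub>R (Dom C u)\<^esub> (f1 (Dom C u, [u]) [a] \<oplus>\<^bsub>R (Dom C u)\<^esub> g (Dom C u, []) [pres A u a]))"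
      using u ab gf by (simp add: r.ring_simprules)
    have r: "pres D'.Aeps u (g_of A g (Cod C u) (a, b)) = (pres A u a, pres A u b
      \<oplus>\<^bsub>R (Dom C u)\<^esub> (pres A u (g (Cod C u, []) [a]) \<oplus>\<^bsub>R (Dom C u)\<^esub> f1' (Dom C u, [u]) [a]))"
      using u ab gf by (simp add: r.ring_simprules)
    have h: "coboundary_eq_11 g (czero1 A) u a \<longleftrightarrow> pres A u (g (Cod C u, []) [a]) \<oplus>\<^bsub>R (Dom C u)\<^esub> f1' (Dom C u, [u]) [a] =
        f1 (Dom C u, [u]) [a] \<oplus>\<^bsub>R (Dom C u)\<^esub> g (Dom C u, []) [pres A u a]"
      unfolding coboundary_eq_11_def czero1_def using u ab gf by (simp add: r.ring_simprules ring_of_simps)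
    show ?thesis unfolding l r h prod.inject r.add_left_cancel_iff[OF bc x1 x2] by auto
  qed
  show ?thesis
    by (simp only: D.Aeps_simps(1))
      (rule ball_Times_iff_ball_fst[where t = "\<zero>\<^bsub>R (Cod C u)\<^esub>"], erule (1) eq, simp add: u)
qed

lemma is_tw_iso_iff:
  assumes g: "cochain_pq C A 0 1 g" and t: "cochain_pq C A 1 0 \<tau>"
  shows "is_tw_iso C D.Aeps D'.Aeps (g_of A g) (tau_of C A \<tau>) \<longleftrightarrow>
    g_normalized g \<and> coboundary_02 g \<and> intertwining g \<tau> \<and> twist_compat \<tau> \<and> tau_unital \<tau>"
proof -
  have algebra: "(\<forall>U\<in>Ob C. alg_map D.Aeps U D'.Aeps U (g_of A g U)) \<longleftrightarrow> g_normalized g \<and> coboundary_02 g"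
    unfolding g_normalized_def coboundary_02_def using g_of_alg_map_iff[OF g] by blast
  have bij: "\<forall>U\<in>Ob C. bij_betw (g_of A g U) (pcar D.Aeps U) (pcar D'.Aeps U)"
    using g_of_bij[OF g] by blast
  have intertwines: "(\<forall>u\<in>Mor C. tau_of C A \<tau> u \<in> pcar D'.Aeps (Dom C u) \<and>
        invertible D'.Aeps (Dom C u) (tau_of C A \<tau> u) \<and>
        (\<forall>a\<in>pcar D.Aeps (Cod C u).
           pmul D'.Aeps (Dom C u) (g_of A g (Dom C u) (pres D.Aeps u a)) (tau_of C A \<tau> u) =
           pmul D'.Aeps (Dom C u) (tau_of C A \<tau> u) (pres D'.Aeps u (g_of A g (Cod C u) a))))
     \<longleftrightarrow> intertwining g \<tau>"
    unfolding intertwining_def using tau_of_intertwines_iff[OF g t] by blast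
  have twist: "g_normalized g \<longrightarrow> (\<forall>u\<in>Mor C. \<forall>v\<in>Mor C. Cod C v = Dom C u \<longrightarrow>
        pmul D'.Aeps (Dom C v) (tau_of C A \<tau> (Comp C u v)) (ptw D'.Aeps u v) =
        pmul D'.Aeps (Dom C v) (pmul D'.Aeps (Dom C v) (g_of A g (Dom C v) (ptw D.Aeps u v)) (tau_of C A \<tau> v))
          (pres D'.Aeps v (tau_of C A \<tau> u)))
     \<longleftrightarrow> twist_compat \<tau>"
    unfolding twist_compat_def using tau_of_twist_iff[OF g t] by blast
  have unital: "(\<forall>U\<in>Ob C. tau_of C A \<tau> (Ident C U) = pone D'.Aeps U) \<longleftrightarrow> tau_unital \<tau>"
    unfolding tau_unital_def by simp
  show ?thesis
    unfolding is_tw_iso_def is_tw_morphism_def using algebra bij intertwines twist unital by argo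
qed

lemma is_pr_iso_iff:
  assumes g: "cochain_pq C A 0 1 g"
  shows "is_pr_iso C D.Aeps D'.Aeps (g_of A g) \<longleftrightarrow>
    g_normalized g \<and> coboundary_02 g \<and> coboundary_11 g (czero1 A)"
proof -
  have "(\<forall>U\<in>Ob C. alg_map D.Aeps U D'.Aeps U (g_of A g U)) \<longleftrightarrow> g_normalized g \<and> coboundary_02 g"
    unfolding g_normalized_def coboundary_02_def using g_of_alg_map_iff[OF g] by blast
  moreover have "(\<forall>u\<in>Mor C. \<forall>x\<in>pcar D.Aeps (Cod C u).
      g_of A g (Dom C u) (pres D.Aeps u x) = pres D'.Aeps u (g_of A g (Cod C u) x)) \<longleftrightarrow>
    coboundary_11 g (czero1 A)"
    unfolding coboundary_11_def using g_of_natural_iff[OF g] by blast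
  ultimately show ?thesis
    unfolding is_pr_iso_def using g_of_bij[OF g] by blast
qed

text \<open>The theorem pairs an equivalence \<open>(1 + g\<^sub>1 \<epsilon>, 1 + \<tau>\<^sub>1 \<epsilon>)\<close> with the cochain
  \<open>(g\<^sub>1, -\<tau>\<^sub>1)\<close>; the next three lemmas absorb that sign.\<close>

lemma reduced_10_neg_iff:
  assumes t: "cochain_pq C A 1 0 \<tau>"
    and tt: "\<And>u V. u \<in> Mor C \<Longrightarrow> V = Dom C u \<Longrightarrow> s (V, [u]) [] = \<ominus>\<^bsub>R V\<^esub> \<tau> (V, [u]) []"
  shows "reduced_10 s \<longleftrightarrow> tau_unital \<tau>"
proof -
  have "reduced_10 s \<longleftrightarrow> (\<forall>u\<in>Mor C. u = Ident C (Dom C u) \<longrightarrow> \<tau> (Dom C u, [u]) [] = \<zero>\<^bsub>R (Dom C u)\<^esub>)"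
    unfolding reduced_10_def
  proof (intro ball_cong refl imp_cong)
    fix u assume u: "u \<in> Mor C"
    interpret r: ring "R (Dom C u)" using ring_R u by simp
    show "(s (Dom C u, [u]) [] = \<zero>\<^bsub>R (Dom C u)\<^esub>) = (\<tau> (Dom C u, [u]) [] = \<zero>\<^bsub>R (Dom C u)\<^esub>)"
      using tt[OF u refl] cochain10_closed[OF t u refl] r.add.inv_eq_1_iff by simp
  qed
  also have "\<dots> \<longleftrightarrow> tau_unital \<tau>"
    unfolding tau_unital_def
  proof safe
    fix U assume h: "\<forall>u\<in>Mor C. u = Ident C (Dom C u) \<longrightarrow> \<tau> (Dom C u, [u]) [] = \<zero>\<^bsub>R (Dom C u)\<^esub>" and U: "U \<in> Ob C"
    show "\<tau> (U, [Ident C U]) [] = \<zero>\<^bsub>R U\<^esub>" using h[rule_format, of "Ident C U"] U by simp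
  next
    fix u assume h: "\<forall>U\<in>Ob C. \<tau> (U, [Ident C U]) [] = \<zero>\<^bsub>R U\<^esub>" and u: "u \<in> Mor C" "u = Ident C (Dom C u)"
    show "\<tau> (Dom C u, [u]) [] = \<zero>\<^bsub>R (Dom C u)\<^esub>" using h u by (metis dom_ob)
  qed
  finally show ?thesis .
qed

lemma coboundary_11_neg_iff:
  assumes g: "cochain_pq C A 0 1 g" and t: "cochain_pq C A 1 0 \<tau>"
    and tt: "\<And>u V. u \<in> Mor C \<Longrightarrow> V = Dom C u \<Longrightarrow> s (V, [u]) [] = \<ominus>\<^bsub>R V\<^esub> \<tau> (V, [u]) []"
  shows "coboundary_11 g s \<longleftrightarrow> intertwining g \<tau>"
proof -
  have "coboundary_eq_11 g s u a \<longleftrightarrow> intertwining_eq g \<tau> u a"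
    if u: "u \<in> Mor C" and a: "a \<in> carrier (R (Cod C u))" for u a
  proof -
    interpret r: ring "R (Dom C u)" using ring_R u by simp
    have U: "Dom C u \<in> Ob C" "Cod C u \<in> Ob C" using u by simp_all
    note gf = cochain01_linear[OF g U(1)] cochain01_linear[OF g U(2)]
    have tc: "\<tau> (Dom C u, [u]) [] \<in> carrier (R (Dom C u))" using cochain10_closed[OF t u] by simp
    have "coboundary_eq_11 g s u a \<longleftrightarrow>
       (pres A u (g (Cod C u, []) [a]) \<oplus>\<^bsub>R (Dom C u)\<^esub> f1' (Dom C u, [u]) [a])
         \<oplus>\<^bsub>R (Dom C u)\<^esub> \<ominus>\<^bsub>R (Dom C u)\<^esub> (pres A u a \<otimes>\<^bsub>R (Dom C u)\<^esub> \<tau> (Dom C u, [u]) []) =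
       (f1 (Dom C u, [u]) [a] \<oplus>\<^bsub>R (Dom C u)\<^esub> g (Dom C u, []) [pres A u a])
         \<oplus>\<^bsub>R (Dom C u)\<^esub> \<ominus>\<^bsub>R (Dom C u)\<^esub> (\<tau> (Dom C u, [u]) [] \<otimes>\<^bsub>R (Dom C u)\<^esub> pres A u a)"
      unfolding coboundary_eq_11_def tt[OF u refl] using u a gf tc by (simp add: r.ring_simprules)
    also have "\<dots> \<longleftrightarrow> intertwining_eq g \<tau> u a"
      apply (subst r.diff_eq_diff_iff)
      using u a gf tc unfolding intertwining_eq_def by (auto simp: r.ring_simprules)
    finally show ?thesis .
  qed
  then show ?thesis unfolding coboundary_11_def intertwining_def by blast
qed

lemma coboundary_20_neg_iff:
  assumes t: "cochain_pq C A 1 0 \<tau>"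
    and tt: "\<And>u V. u \<in> Mor C \<Longrightarrow> V = Dom C u \<Longrightarrow> s (V, [u]) [] = \<ominus>\<^bsub>R V\<^esub> \<tau> (V, [u]) []"
  shows "coboundary_20 s \<longleftrightarrow> twist_compat \<tau>"
proof -
  have "coboundary_eq_20 s u v \<longleftrightarrow> twist_compat_eq \<tau> u v"
    if uv: "u \<in> Mor C" "v \<in> Mor C" "Cod C v = Dom C u" for u v
  proof -
    interpret r: ring "R (Dom C v)" using ring_R uv by simp
    note tc = cochain10_closed[OF t]
    have e1: "s (Dom C u, [u]) [] = \<ominus>\<^bsub>R (Dom C u)\<^esub> \<tau> (Dom C u, [u]) []" using tt uv by simp
    have e2: "s (Dom C v, [v]) [] = \<ominus>\<^bsub>R (Dom C v)\<^esub> \<tau> (Dom C v, [v]) []" using tt uv by simp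
    have e3: "s (Dom C v, [Comp C u v]) [] = \<ominus>\<^bsub>R (Dom C v)\<^esub> \<tau> (Dom C v, [Comp C u v]) []" using tt[of "Comp C u v"] uv by simp
    have "coboundary_eq_20 s u v \<longleftrightarrow>
       c1' (Dom C v, [v, u]) [] \<oplus>\<^bsub>R (Dom C v)\<^esub> \<ominus>\<^bsub>R (Dom C v)\<^esub> (pres A v (\<tau> (Dom C u, [u]) [])
         \<oplus>\<^bsub>R (Dom C v)\<^esub> \<tau> (Dom C v, [v]) []) =
       c1 (Dom C v, [v, u]) [] \<oplus>\<^bsub>R (Dom C v)\<^esub> \<ominus>\<^bsub>R (Dom C v)\<^esub> \<tau> (Dom C v, [Comp C u v]) []"
      unfolding coboundary_eq_20_def e1 e2 e3 using uv by (simp add: r.ring_simprules tc)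
    also have "\<dots> \<longleftrightarrow> twist_compat_eq \<tau> u v"
      apply (subst r.diff_eq_diff_iff)
      using uv unfolding twist_compat_eq_def by (auto simp: r.ring_simprules tc)
    finally show ?thesis .
  qed
  then show ?thesis unfolding coboundary_20_def twist_compat_def by blast
qed

end

section \<open>Classification of first order deformations\<close>

context gs_presheaf
begin

lemma cochain_pq_czero1: "cochain_pq C A p 0 (czero1 A)"
  unfolding cochain_pq_def mlin_def args_def czero1_def
  by (auto simp: ring_of_simps nerve_def)

lemma cochain_pq_cneg: "cochain_pq C A 1 0 \<tau> \<Longrightarrow> cochain_pq C A 1 0 (cneg A \<tau>)"
  unfolding cochain_pq1_iff mlin0 cneg_def by (simp add: ring.ring_simprules(3)[OF ring_R])

lemma cneg_eq: "cochain_pq C A 1 0 \<tau> \<Longrightarrow> u \<in> Mor C \<Longrightarrow> V = Dom C u \<Longrightarrow>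
   cneg A \<tau> (V, [u]) [] = \<ominus>\<^bsub>R V\<^esub> \<tau> (V, [u]) []"
  unfolding cochain_pq1_iff mlin0 cneg_def by simp

lemma NR1_pack2_eta: "NR C A 1 B = NR C A 1 (pack2 (B 0) (B 1))"
  unfolding NR_def cochain_def normalized_def reduced_def all_le_1 pack2_def by simp

lemma NRt1_pack2_eta: "NRt C A 1 B = NRt C A 1 (pack2 (B 0) (B 1))"
  unfolding NRt_def using NR1_pack2_eta by (simp add: pack2_def)

lemma ceq_dGS1_pack2_eta: "ceq C A 2 (dGS C A 1 B) X = ceq C A 2 (dGS C A 1 (pack2 (B 0) (B 1))) X"
  unfolding ceq_def all_le_2 by (simp add: dGS_def pack2_def)

lemma NRt1_czero1_iff: "NRt C A 1 (pack2 g1 (czero1 A)) \<longleftrightarrow> NR C A 1 (pack2 g1 (czero1 A))"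
  unfolding NRt_def pack2_def czero1_def by simp

lemma NRt2_czero1_iff: "NRt C A 2 (pack3 m1 f1 (czero1 A)) \<longleftrightarrow> NR C A 2 (pack3 m1 f1 (czero1 A))"
  unfolding NRt_def pack3_def czero1_def by simp

lemma Z2_if_Z2t: "(m1, f1) \<in> Z2t C A \<Longrightarrow> (m1, f1, czero1 A) \<in> Z2 C A"
  unfolding Z2t_def Z2_def NRt_def by blast

lemma tw_deformation_iff_cocycle:
  assumes "cochain_pq C A 0 2 m1" "cochain_pq C A 1 1 f1" "cochain_pq C A 2 0 c1"
  shows "is_tw_deformation C A m1 f1 c1 \<longleftrightarrow>
    NR C A 2 (pack3 m1 f1 c1) \<and> ceq C A 3 (dGS C A 2 (pack3 m1 f1 c1)) (czero A)"
proof -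
  interpret first_order_data C A m1 f1 c1 using assms by unfold_locales
  show ?thesis by (rule is_tw_deformation_iff)
qed

lemma pr_deformation_iff_cocycle:
  assumes "cochain_pq C A 0 2 m1" "cochain_pq C A 1 1 f1"
  shows "is_pr_deformation C A m1 f1 \<longleftrightarrow>
    NRt C A 2 (pack3 m1 f1 (czero1 A)) \<and> ceq C A 3 (dGS C A 2 (pack3 m1 f1 (czero1 A))) (czero A)"
  unfolding is_pr_deformation_def NRt2_czero1_iff using tw_deformation_iff_cocycle[OF assms cochain_pq_czero1] .

lemma Z2_eq_TwDefs: "Z2 C A = TwDefs C A"
proof -
  have "(m1, f1, c1) \<in> Z2 C A \<longleftrightarrow> (m1, f1, c1) \<in> TwDefs C A" for m1 f1 c1
  proof (cases "cochain_pq C A 0 2 m1 \<and> cochain_pq C A 1 1 f1 \<and> cochain_pq C A 2 0 c1")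
    case True
    then show ?thesis unfolding Z2_def TwDefs_def using tw_deformation_iff_cocycle by auto
  next
    case False
    then show ?thesis unfolding Z2_def TwDefs_def NR_def is_tw_deformation_def cochain_pack3_iff by auto
  qed
  then show ?thesis by (simp add: set_eq_iff split_paired_All)
qed

lemma Z2t_eq_PrDefs: "Z2t C A = PrDefs C A"
proof -
  have "(m1, f1) \<in> Z2t C A \<longleftrightarrow> (m1, f1) \<in> PrDefs C A" for m1 f1
  proof (cases "cochain_pq C A 0 2 m1 \<and> cochain_pq C A 1 1 f1")
    case True
    then show ?thesis unfolding Z2t_def PrDefs_def using pr_deformation_iff_cocycle by auto
  next
    case False
    then show ?thesis
      unfolding Z2t_def PrDefs_def NRt_def NR_def is_pr_deformation_def is_tw_deformation_def cochain_pack3_iff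
      by auto
  qed
  then show ?thesis by (simp add: set_eq_iff split_paired_All)
qed

end

context cocycle_pair
begin

lemma tw_iso_iff_coboundary:
  assumes g: "cochain_pq C A 0 1 g1" and t: "cochain_pq C A 1 0 \<tau>1"
  shows "is_tw_iso C D.Aeps D'.Aeps (g_of A g1) (tau_of C A \<tau>1) \<longleftrightarrow>
    NR C A 1 (pack2 g1 (cneg A \<tau>1)) \<and>
    ceq C A 2 (dGS C A 1 (pack2 g1 (cneg A \<tau>1))) (csub A (pack3 m1 f1 c1) (pack3 m1' f1' c1'))"
proof -
  have tt: "\<And>u V. u \<in> Mor C \<Longrightarrow> V = Dom C u \<Longrightarrow> cneg A \<tau>1 (V, [u]) [] = \<ominus>\<^bsub>R V\<^esub> \<tau>1 (V, [u]) []"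
    using cneg_eq[OF t] by blast
  show ?thesis
    unfolding is_tw_iso_iff[OF g t] NR1_dGS1_eq_iff[OF g cochain_pq_cneg[OF t]]
    using reduced_10_neg_iff[where s = "cneg A \<tau>1", OF t tt] coboundary_11_neg_iff[where s = "cneg A \<tau>1", OF g t tt]
      coboundary_20_neg_iff[where s = "cneg A \<tau>1", OF t tt]
    by blast
qed

lemma tw_equivalent_if_cohomologous:
  assumes nr: "NR C A 1 B" and ce: "ceq C A 2 (dGS C A 1 B) (csub A (pack3 m1 f1 c1) (pack3 m1' f1' c1'))"
  shows "\<exists>g1 \<tau>1. cochain_pq C A 0 1 g1 \<and> cochain_pq C A 1 0 \<tau>1 \<and>
    is_tw_iso C D.Aeps D'.Aeps (g_of A g1) (tau_of C A \<tau>1)"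
proof -
  have nr': "NR C A 1 (pack2 (B 0) (B 1))" using nr NR1_pack2_eta by simp
  have g: "cochain_pq C A 0 1 (B 0)" and t: "cochain_pq C A 1 0 (B 1)"
    using nr' unfolding NR_def cochain_pack2_iff by blast+
  have t': "cochain_pq C A 1 0 (cneg A (B 1))" using cochain_pq_cneg[OF t] .
  have tt: "B 1 (V, [u]) [] = \<ominus>\<^bsub>R V\<^esub> cneg A (B 1) (V, [u]) []" if "u \<in> Mor C" "V = Dom C u" for u V
  proof -
    interpret r: ring "R V" using ring_R that by simp
    show ?thesis using cneg_eq[OF t that] cochain10_closed[OF t that] by simp
  qed
  have "g_normalized (B 0) \<and> reduced_10 (B 1) \<and> coboundary_02 (B 0) \<and> coboundary_11 (B 0) (B 1) \<and>
      coboundary_20 (B 1)"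
    using NR1_dGS1_eq_iff[OF g t] nr' ce ceq_dGS1_pack2_eta by blast
  then have "is_tw_iso C D.Aeps D'.Aeps (g_of A (B 0)) (tau_of C A (cneg A (B 1)))"
    unfolding is_tw_iso_iff[OF g t']
    using reduced_10_neg_iff[where s = "B 1", OF t' tt] coboundary_11_neg_iff[where s = "B 1", OF g t' tt]
      coboundary_20_neg_iff[where s = "B 1", OF t' tt]
    by blast
  then show ?thesis using g t' by blast
qed

lemma cohomologous_iff_tw_equivalent:
  "(\<exists>B. NR C A 1 B \<and> ceq C A 2 (dGS C A 1 B) (csub A (pack3 m1 f1 c1) (pack3 m1' f1' c1'))) \<longleftrightarrow>
   (\<exists>g1 \<tau>1. cochain_pq C A 0 1 g1 \<and> cochain_pq C A 1 0 \<tau>1 \<and>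
      is_tw_iso C D.Aeps D'.Aeps (g_of A g1) (tau_of C A \<tau>1))"
  using tw_equivalent_if_cohomologous tw_iso_iff_coboundary by blast

lemma coboundary_11_cong:
  "(\<And>u. u \<in> Mor C \<Longrightarrow> s (Dom C u, [u]) [] = t (Dom C u, [u]) []) \<Longrightarrow> coboundary_11 g s = coboundary_11 g t"
  unfolding coboundary_11_def coboundary_eq_11_def by simp

context
  assumes untwisted: "c1 = czero1 A" "c1' = czero1 A"
begin

lemma pr_iso_iff_coboundary:
  assumes g: "cochain_pq C A 0 1 g1"
  shows "is_pr_iso C D.Aeps D'.Aeps (g_of A g1) \<longleftrightarrow>
    NRt C A 1 (pack2 g1 (czero1 A)) \<and>
    ceq C A 2 (dGS C A 1 (pack2 g1 (czero1 A))) (csub A (pack3 m1 f1 c1) (pack3 m1' f1' c1'))"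
proof -
  have "reduced_10 (czero1 A)"
    unfolding reduced_10_def czero1_def by (simp add: ring_of_simps)
  moreover have "coboundary_eq_20 (czero1 A) u v" if uv: "u \<in> Mor C" "v \<in> Mor C" "Cod C v = Dom C u" for u v
  proof -
    interpret r: ring "R (Dom C v)" using ring_R uv by simp
    show ?thesis
      unfolding coboundary_eq_20_def unfolding untwisted czero1_def using uv by (simp add: ring_of_simps)
  qed
  ultimately show ?thesis
    unfolding is_pr_iso_iff[OF g] NRt1_czero1_iff NR1_dGS1_eq_iff[OF g cochain_pq_czero1] coboundary_20_def
    by blast
qed

lemma pr_equivalent_if_cohomologous:
  assumes nr: "NRt C A 1 B" and ce: "ceq C A 2 (dGS C A 1 B) (csub A (pack3 m1 f1 c1) (pack3 m1' f1' c1'))"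
  shows "\<exists>g1. cochain_pq C A 0 1 g1 \<and> is_pr_iso C D.Aeps D'.Aeps (g_of A g1)"
proof -
  have nr': "NRt C A 1 (pack2 (B 0) (B 1))" using nr NRt1_pack2_eta by simp
  have g: "cochain_pq C A 0 1 (B 0)" and t: "cochain_pq C A 1 0 (B 1)"
    using nr' unfolding NRt_def NR_def cochain_pack2_iff by blast+
  have "B 1 (Dom C u, [u]) [] = czero1 A (Dom C u, [u]) []" if "u \<in> Mor C" for u
    using nr' that unfolding NRt_def ball_nerve1 pack2_def czero1_def by auto
  then have "coboundary_11 (B 0) (B 1) = coboundary_11 (B 0) (czero1 A)"
    by (rule coboundary_11_cong)
  moreover have "g_normalized (B 0) \<and> coboundary_02 (B 0) \<and> coboundary_11 (B 0) (B 1)"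
    using NR1_dGS1_eq_iff[OF g t] nr' ce ceq_dGS1_pack2_eta unfolding NRt_def by blast
  ultimately show ?thesis using g is_pr_iso_iff[OF g] by blast
qed

lemma cohomologous_iff_pr_equivalent:
  "(\<exists>B. NRt C A 1 B \<and> ceq C A 2 (dGS C A 1 B) (csub A (pack3 m1 f1 c1) (pack3 m1' f1' c1'))) \<longleftrightarrow>
   (\<exists>g1. cochain_pq C A 0 1 g1 \<and> is_pr_iso C D.Aeps D'.Aeps (g_of A g1))"
  using pr_equivalent_if_cohomologous pr_iso_iff_coboundary by blast

end

end

context gs_presheaf
begin

lemma deform_tw_iso_iff:
  assumes "(m1, f1, c1) \<in> Z2 C A" and "(m1', f1', c1') \<in> Z2 C A"
    and "cochain_pq C A 0 1 g1" and "cochain_pq C A 1 0 \<tau>1"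
  shows "is_tw_iso C (deform C A m1 f1 c1) (deform C A m1' f1' c1') (g_of A g1) (tau_of C A \<tau>1) \<longleftrightarrow>
    NR C A 1 (pack2 g1 (cneg A \<tau>1)) \<and>
    ceq C A 2 (dGS C A 1 (pack2 g1 (cneg A \<tau>1))) (csub A (pack3 m1 f1 c1) (pack3 m1' f1' c1'))"
proof -
  interpret cocycle_pair C A m1 f1 c1 m1' f1' c1' using assms(1,2) by unfold_locales
  show ?thesis using tw_iso_iff_coboundary[OF assms(3,4)] .
qed

lemma deform_pr_iso_iff:
  assumes "(m1, f1) \<in> Z2t C A" and "(m1', f1') \<in> Z2t C A" and "cochain_pq C A 0 1 g1"
  shows "is_pr_iso C (deform C A m1 f1 (czero1 A)) (deform C A m1' f1' (czero1 A)) (g_of A g1) \<longleftrightarrow>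
    NRt C A 1 (pack2 g1 (czero1 A)) \<and>
    ceq C A 2 (dGS C A 1 (pack2 g1 (czero1 A))) (csub A (pack3 m1 f1 (czero1 A)) (pack3 m1' f1' (czero1 A)))"
proof -
  interpret cocycle_pair C A m1 f1 "czero1 A" m1' f1' "czero1 A"
    using Z2_if_Z2t[OF assms(1)] Z2_if_Z2t[OF assms(2)] by unfold_locales
  show ?thesis using pr_iso_iff_coboundary[OF refl refl assms(3)] .
qed

lemma cohrel_eq_tw_equiv: "cohrel C A = tw_equiv C A"
proof -
  have "((m1, f1, c1), (m1', f1', c1')) \<in> cohrel C A \<longleftrightarrow> ((m1, f1, c1), (m1', f1', c1')) \<in> tw_equiv C A"
    for m1 f1 c1 m1' f1' c1'
  proof (cases "(m1, f1, c1) \<in> Z2 C A \<and> (m1', f1', c1') \<in> Z2 C A")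
    case True
    then interpret cocycle_pair C A m1 f1 c1 m1' f1' c1' by unfold_locales blast+
    show ?thesis unfolding cohrel_def tw_equiv_def using True cohomologous_iff_tw_equivalent Z2_eq_TwDefs by auto
  next
    case False
    then show ?thesis unfolding cohrel_def tw_equiv_def using Z2_eq_TwDefs by auto
  qed
  then show ?thesis by (simp add: set_eq_iff split_paired_All)
qed

lemma cohrel_t_eq_pr_equiv: "cohrel_t C A = pr_equiv C A"
proof -
  have "((m1, f1), (m1', f1')) \<in> cohrel_t C A \<longleftrightarrow> ((m1, f1), (m1', f1')) \<in> pr_equiv C A" for m1 f1 m1' f1'
  proof (cases "(m1, f1) \<in> Z2t C A \<and> (m1', f1') \<in> Z2t C A")
    case True
    then interpret cocycle_pair C A m1 f1 "czero1 A" m1' f1' "czero1 A"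
      using Z2_if_Z2t by unfold_locales blast+
    show ?thesis
      unfolding cohrel_t_def pr_equiv_def using True cohomologous_iff_pr_equivalent[OF refl refl] Z2t_eq_PrDefs
      by auto
  next
    case False
    then show ?thesis unfolding cohrel_t_def pr_equiv_def using Z2t_eq_PrDefs by auto
  qed
  then show ?thesis by (simp add: set_eq_iff split_paired_All)
qed

end

theorem theorem2p21:

  fixes C :: "('o,'m) cat" and A :: "('o,'m,'a,'k::comm_ring_1) tpsh"
  assumes "is_category C" and "is_presheaf C A"
  shows
   "(\<forall>m1 f1 c1. cochain_pq C A 0 2 m1 \<and> cochain_pq C A 1 1 f1 \<and> cochain_pq C A 2 0 c1 \<longrightarrow>
      (is_tw_deformation C A m1 f1 c1 \<longleftrightarrow>
         NR C A 2 (pack3 m1 f1 c1) \<and> ceq C A 3 (dGS C A 2 (pack3 m1 f1 c1)) (czero A)))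
  \<and> (\<forall>m1 f1. cochain_pq C A 0 2 m1 \<and> cochain_pq C A 1 1 f1 \<longrightarrow>
      (is_pr_deformation C A m1 f1 \<longleftrightarrow>
         NRt C A 2 (pack3 m1 f1 (czero1 A)) \<and>
         ceq C A 3 (dGS C A 2 (pack3 m1 f1 (czero1 A))) (czero A)))
  \<and> (\<forall>m1 f1 c1 m1' f1' c1' g1 \<tau>1.
       (m1, f1, c1) \<in> Z2 C A \<and> (m1', f1', c1') \<in> Z2 C A \<and>
       cochain_pq C A 0 1 g1 \<and> cochain_pq C A 1 0 \<tau>1 \<longrightarrow>
      (is_tw_iso C (deform C A m1 f1 c1) (deform C A m1' f1' c1') (g_of A g1) (tau_of C A \<tau>1) \<longleftrightarrow>
         NR C A 1 (pack2 g1 (cneg A \<tau>1)) \<and>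
         ceq C A 2 (dGS C A 1 (pack2 g1 (cneg A \<tau>1))) (csub A (pack3 m1 f1 c1) (pack3 m1' f1' c1'))))
  \<and> (\<forall>m1 f1 m1' f1' g1.
       (m1, f1) \<in> Z2t C A \<and> (m1', f1') \<in> Z2t C A \<and> cochain_pq C A 0 1 g1 \<longrightarrow>
      (is_pr_iso C (deform C A m1 f1 (czero1 A)) (deform C A m1' f1' (czero1 A)) (g_of A g1) \<longleftrightarrow>
         NRt C A 1 (pack2 g1 (czero1 A)) \<and>
         ceq C A 2 (dGS C A 1 (pack2 g1 (czero1 A)))
                   (csub A (pack3 m1 f1 (czero1 A)) (pack3 m1' f1' (czero1 A)))))
  \<and> (\<exists>F. bij_betw F (Z2 C A // cohrel C A) (TwDefs C A // tw_equiv C A) \<and>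
         (\<forall>x\<in>Z2 C A. F (cohrel C A `` {x}) = tw_equiv C A `` {x}))
  \<and> (\<exists>F. bij_betw F (Z2t C A // cohrel_t C A) (PrDefs C A // pr_equiv C A) \<and>
         (\<forall>x\<in>Z2t C A. F (cohrel_t C A `` {x}) = pr_equiv C A `` {x}))"
proof -
  interpret gs_presheaf C A using assms by unfold_locales
  have "\<exists>F. bij_betw F (Z2 C A // cohrel C A) (TwDefs C A // tw_equiv C A) \<and>
      (\<forall>x\<in>Z2 C A. F (cohrel C A `` {x}) = tw_equiv C A `` {x})"
    by (rule exI[of _ id]) (simp add: Z2_eq_TwDefs cohrel_eq_tw_equiv)
  moreover have "\<exists>F. bij_betw F (Z2t C A // cohrel_t C A) (PrDefs C A // pr_equiv C A) \<and>
      (\<forall>x\<in>Z2t C A. F (cohrel_t C A `` {x}) = pr_equiv C A `` {x})"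
    by (rule exI[of _ id]) (simp add: Z2t_eq_PrDefs cohrel_t_eq_pr_equiv)
  ultimately show ?thesis
    by (simp add: tw_deformation_iff_cocycle pr_deformation_iff_cocycle deform_tw_iso_iff deform_pr_iso_iff)
qed

end
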